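(* (i) Let $\mu\in\mathcal{P}(\mathbb{I})$ be $G$-invariant and such that the stationary process $(\mathbb{I},\mu,G,a)$ is continued fraction mixing. Then $\mu$-a.e. $x\in\mathbb{I}$ is Diophantine if $\mathbb{E}_\mu(\log a)<\infty$, and $\mu$-a.e. $x\in\mathbb{I}$ is Liouville if $\mathbb{E}_\mu(\log a)=\infty$. (ii) For each $r\in\mathbb{R}_+$ there exists a $G$-invariant, ergodic $p_r\in\mathcal{P}(\mathbb{I})$ such that $\mathbbm{i}=2+r$ $p_r$-a.s.
   Context: $\mathbb{R}_+=[0,\infty)$, $\mathbb{N}=\{1,2,\dots\}$. $\mathbb{I}:=[0,1]\setminus\mathbb{Q}$ and $\mathcal{P}(\mathbb{I})$ is the set of Borel probability measures on $\mathbb{I}$. $G:\mathbb{I}\to\mathbb{I}$, $G(x):=\frac1x-\lfloor\frac1x\rfloor$ is the Gauss map, and $a(x):=\lfloor\frac1x\rfloor\in\mathbb{N}$. $\mathbb{E}_\mu$ denotes integration with respect to $\mu$. Irrationality exponent. $x\in\mathbb{I}$ is badly approximable of order $s>0$ ($s$-BA) if there is $c>0$ with $\min_{0\le p\le q}|x-\frac pq|\ge \frac{c}{q^s}$ for all sufficiently large $q\in\mathbb{N}$. $\mathbbm{i}(x):=\inf\{s>0: x\text{ is } s\text{-BA}\}\le\infty$ ($\inf\emptyset=\infty$). $x$ is Diophantine if $\mathbbm{i}(x)=2$, and Liouville if $\mathbbm{i}(x)=\infty$. Continued fraction mixing. The process $(\mathbb{I},\mu,G,a)$ (with $\mu$ $G$-invariant)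 is continued fraction mixing if there are numbers $\vartheta(N)\ge0$ ($N\ge1$) with $\vartheta(N)\downarrow0$ such that for all $n,N\ge1$, all $A\in\sigma(\{a\circ G^k:0\le k\le n\})$ and all $B\in\sigma(\{a\circ G^\ell:\ell\ge n+N\})$, $|\mu(A\cap B)-\mu(A)\mu(B)|\le\vartheta(N)\mu(A)\mu(B)$. *)

theory Defs
  imports "HOL-Probability.Probability"
begin

section \<open>The Gauss map and continued fraction digits\<close>

definition irrational_unit :: "real set" where
  "irrational_unit = {0..1} - \<rat>"

definition gauss_map :: "real \<Rightarrow> real" where
  "gauss_map x = frac (1 / x)"

definition digit :: "real \<Rightarrow> nat" where
  "digit x = nat \<lfloor>1 / x\<rfloor>"

section \<open>Irrationality exponent\<close>

definition badly_approximable :: "real \<Rightarrow> real \<Rightarrow> bool" where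
  "badly_approximable s x \<longleftrightarrow>
     (\<exists>c>0. \<forall>\<^sub>F q::nat in sequentially.
        (MIN p\<in>{0..q}. \<bar>x - real p / real q\<bar>) \<ge> c / real q powr s)"

(* The infimum is taken in the extended reals, so that it is \<infinity> on the empty set. *)
definition irrationality_exponent :: "real \<Rightarrow> ereal" where
  "irrationality_exponent x = (INF s\<in>{s. s > 0 \<and> badly_approximable s x}. ereal s)"

definition diophantine :: "real \<Rightarrow> bool" where
  "diophantine x \<longleftrightarrow> irrationality_exponent x = 2"

definition liouville :: "real \<Rightarrow> bool" where
  "liouville x \<longleftrightarrow> irrationality_exponent x = \<infinity>"

section \<open>Invariant measures, ergodicity and mixing\<close>

definition borel_probabilities :: "'a::topological_space set \<Rightarrow> 'a measure set" where
  "borel_probabilities S = {M. prob_space M \<and> sets M = sets (restrict_space borel S)}"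

definition invariant_measure :: "('a \<Rightarrow> 'a) \<Rightarrow> 'a measure \<Rightarrow> bool" where
  "invariant_measure T M \<longleftrightarrow> T \<in> measurable M M \<and> distr M M T = M"

definition ergodic_measure :: "('a \<Rightarrow> 'a) \<Rightarrow> 'a measure \<Rightarrow> bool" where
  "ergodic_measure T M \<longleftrightarrow>
     (\<forall>A\<in>sets M. T -` A \<inter> space M = A \<longrightarrow> measure M A = 0 \<or> measure M A = 1)"

(* The sigma-algebra on the irrational unit interval generated by the functions
   digit \<circ> gauss_map ^^ k with k \<in> K.  As digits are natural numbers, all sets S of
   values are measurable. *)
definition digit_algebra :: "nat set \<Rightarrow> real set set" where
  "digit_algebra K = sigma_sets irrational_unit
     (\<Union>k\<in>K. {(digit \<circ> gauss_map ^^ k) -` S \<inter> irrational_unit | S. True})"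

definition cf_mixing :: "real measure \<Rightarrow> bool" where
  "cf_mixing M \<longleftrightarrow>
     (\<exists>\<theta> :: nat \<Rightarrow> real.
        (\<forall>N\<ge>1. \<theta> N \<ge> 0) \<and> antimono_on {1..} \<theta> \<and> \<theta> \<longlonglongrightarrow> 0 \<and>
        (\<forall>n\<ge>1. \<forall>N\<ge>1. \<forall>A\<in>digit_algebra {0..n}. \<forall>B\<in>digit_algebra {n+N..}.
           \<bar>measure M (A \<inter> B) - measure M A * measure M B\<bar>
             \<le> \<theta> N * measure M A * measure M B))"

end

(* With a_n the digits and q_n the convergent denominators of x, the exponent of x is
   2 + limsup (ln a_n / ln q_n) (here q_(n+1) = a_n q_n + q_(n-1)).

   Finite E(log a): Borel-Cantelli gives ln a_n = o(n), while ln q_n grows at least linearly.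

   Infinite E(log a): let X_n = ln (a_n + 2) and S_n = X_0 + ... + X_(n-1), so ln q_n <= S_n.
   With m(t) = E(min X t), Markov's inequality gives P(S_n < t) >= 1/2 for n <= t / (2 m(t)),
   hence the probabilities of {X_(n+1+N) > K S_n} have a sum of the order E(X / m(X)), which is
   infinite. Mixing and stationarity give P(A_m A_n) <= C P(A_m) P(A_(n-m-N-2)) for these events, so
   by a Kochen-Stone argument they occur infinitely often with a probability bounded below
   uniformly in K. The resulting event is invariant, hence has probability 1. The gap N is removed
   deterministically: if X_j <= K' S_j throughout the gap, then X_(n+1+N) <= (1 + K')^(N+2) S_n.

   Exponent 2 + r: let w_k = 2^J_k with J_k i.i.d. geometric, f_n = sup over k >= n of
   (w_k - (k - n)), and let the digits be exp((1 + r)^f_n), rounded up. As f_(n+1) <= f_n + 1, each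
   log-digit is at most (1 + r) times its predecessor, hence asymptotically at most r times the
   sum of its past. At the first occurrence of J_n >= j the past is, up to a negligible term, a full
   geometric ramp, and the bound is attained. The process is a factor of a Bernoulli shift, whence
   ergodicity. *)

theory Submission
  imports Defs "HOL-Real_Asymp.Real_Asymp"
begin

section \<open>Continued fractions and the irrationality exponent\<close>

text \<open>Mixing bounds P(A B) from below only once theta(N) < 1, but from above for any gap. This
  asymmetry shapes the infinite case: divergence of the probabilities needs a gap N with theta(N) <=
  1/2, whereas the correlation bound gets by with gap 1 and C = 1 + theta(1). Since that bound
  refers to the lagged index n - m - N - 2, partial sums of probabilities from 0 and from a late
  index have to be compared.

  For r > 0, independent digits are excluded by the first part, which leaves only the exponents 2
  and infinity. Hence the digits look ahead: each large digit is announced by a ramp of ratio 1 + r,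
  whose logarithms add up to at most 1/r times the top. The heights are powers of 2 so that at a new
  record of J all older peaks are at most half as high; what they contribute to one log-digit is
  then at most the square root of the top. The law P(J = j) = (3/4) 4^-j is light enough for E(2^J)
  to be finite, so that the supremum is finite, and heavy enough for a value >= j to occur before
  time 16^j, which is negligible against (1 + r)^(2^j).\<close>

lemma irrational_unitD:
  assumes "x \<in> irrational_unit"
  shows "0 < x" "x < 1" "x \<notin> \<rat>"
  using assms by (auto simp: irrational_unit_def less_le)

lemma irrational_unitI: "0 < x \<Longrightarrow> x < 1 \<Longrightarrow> x \<notin> \<rat> \<Longrightarrow> x \<in> irrational_unit"
  by (auto simp: irrational_unit_def)

lemma gauss_map_irrational_unit:
  assumes "x \<in> irrational_unit"
  shows "gauss_map x \<in> irrational_unit"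
proof -
  note x = irrational_unitD[OF assms]
  have "gauss_map x \<notin> \<rat>"
  proof
    assume "gauss_map x \<in> \<rat>"
    then have "gauss_map x + of_int \<lfloor>1/x\<rfloor> \<in> \<rat>" by simp
    then have "1/x \<in> \<rat>" by (simp add: gauss_map_def frac_def)
    then show False using x Rats_inverse[of "1/x"] by (simp add: field_simps)
  qed
  moreover from this have "gauss_map x \<noteq> 0" by auto
  moreover have "gauss_map x \<ge> 0" "gauss_map x < 1"
    by (auto simp: gauss_map_def frac_lt_1)
  ultimately show ?thesis by (intro irrational_unitI) auto
qed

lemma funpow_gauss_map_irrational_unit:
  "x \<in> irrational_unit \<Longrightarrow> (gauss_map ^^ n) x \<in> irrational_unit"
  by (induction n) (auto intro: gauss_map_irrational_unit)

lemma digit_plus_gauss_map: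
  assumes "x > 0"
  shows "real (digit x) + gauss_map x = 1 / x"
  using assms by (simp add: digit_def gauss_map_def frac_def)

lemma digit_pos:
  assumes "x \<in> irrational_unit"
  shows "digit x \<ge> 1"
proof -
  note x = irrational_unitD[OF assms]
  have "\<lfloor>1/x\<rfloor> \<ge> 1" using x by (simp add: le_floor_iff)
  then have "nat \<lfloor>1/x\<rfloor> \<ge> nat 1" by (rule nat_mono)
  then show ?thesis by (simp add: digit_def)
qed

section \<open>Partial quotients and the recursions of the convergents\<close>

definition cf_digit :: "real \<Rightarrow> nat \<Rightarrow> nat" where
  "cf_digit x n = digit ((gauss_map ^^ n) x)"

lemma cf_digit_pos: "x \<in> irrational_unit \<Longrightarrow> cf_digit x n \<ge> 1"
  unfolding cf_digit_def by (intro digit_pos funpow_gauss_map_irrational_unit)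

text \<open>Digits are numbered from 0, so the denominator of index n involves only the digits below
  n, and \<open>a n\<close> is the digit that leads from index n to \<open>Suc n\<close>. This is
  why the exponent compares \<open>a n\<close> with \<open>cf_denom a n\<close>.\<close>

fun cf_denom :: "(nat \<Rightarrow> nat) \<Rightarrow> nat \<Rightarrow> nat" where
  "cf_denom a 0 = 1"
| "cf_denom a (Suc 0) = a 0"
| "cf_denom a (Suc (Suc n)) = a (Suc n) * cf_denom a (Suc n) + cf_denom a n"

fun cf_num :: "(nat \<Rightarrow> nat) \<Rightarrow> nat \<Rightarrow> nat" where
  "cf_num a 0 = 0"
| "cf_num a (Suc 0) = 1"
| "cf_num a (Suc (Suc n)) = a (Suc n) * cf_num a (Suc n) + cf_num a n"

context
  fixes a :: "nat \<Rightarrow> nat"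
  assumes a_pos: "\<And>n. a n \<ge> 1"
begin

lemma cf_denom_pos: "cf_denom a n \<ge> 1"
  using a_pos by (induction n rule: induct_nat_012) (auto simp: Suc_le_eq)

lemma cf_denom_Suc_ge: "a n * cf_denom a n \<le> cf_denom a (Suc n)"
  by (cases n) auto

lemma cf_denom_le_Suc: "cf_denom a n \<le> cf_denom a (Suc n)"
  using cf_denom_Suc_ge[of n] a_pos[of n] by (metis le_trans mult_le_mono1 nat_mult_1)

lemma cf_denom_mono: "m \<le> n \<Longrightarrow> cf_denom a m \<le> cf_denom a n"
  by (rule lift_Suc_mono_le[of "cf_denom a"]) (use cf_denom_le_Suc in auto)

lemma cf_denom_Suc_le: "cf_denom a (Suc n) \<le> (a n + 1) * cf_denom a n"
proof (cases n)
  case (Suc m)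
  then show ?thesis using cf_denom_le_Suc[of m] by simp
qed auto

text \<open>Two steps of the recursion at least double the denominator. Working with the square
  avoids a split by parity, and the factor 2 absorbs the index 1.\<close>

lemma cf_denom_exponential: "2 ^ n \<le> 2 * (cf_denom a n)\<^sup>2"
proof (induction n rule: nat_less_induct)
  case (1 n)
  consider "n = 0" | "n = 1" | m where "n = Suc (Suc m)"
    by (metis One_nat_def not0_implies_Suc)
  then show ?case
  proof cases
    case 2
    then show ?thesis using a_pos[of 0] by simp
  next
    case 3
    have "2 * cf_denom a m \<le> cf_denom a (Suc (Suc m))"
      using cf_denom_Suc_ge[of "Suc m"] cf_denom_le_Suc[of m] a_pos[of "Suc m"]
      by simp (metis add.commute add_le_mono le_trans mult.commute mult_2 mult_le_mono2 mult_numeral_1_right numeral_1_eq_Suc_0 numeral_One order_refl)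
    then have "(2 * cf_denom a m)\<^sup>2 \<le> (cf_denom a (Suc (Suc m)))\<^sup>2"
      by (rule power_mono) simp
    moreover have "2 ^ m \<le> 2 * (cf_denom a m)\<^sup>2" using 1 3 by simp
    ultimately show ?thesis using 3 by (simp add: power2_eq_square)
  qed auto
qed

lemma cf_num_le_denom: "cf_num a n \<le> cf_denom a n"
proof (induction n rule: induct_nat_012)
  case (ge2 n)
  then show ?case by (simp add: add_mono)
qed (use a_pos[of 0] in auto)

end

lemma ln_cf_denom_le_sum:
  assumes a: "\<And>k. a k \<ge> 1"
  shows "ln (real (cf_denom a n)) \<le> (\<Sum>k<n. ln (real (a k) + 1))"
proof (induction n)
  case (Suc n)
  have q: "cf_denom a m \<ge> 1" for m using cf_denom_pos[OF a] .
  have "real (cf_denom a (Suc n)) \<le> real ((a n + 1) * cf_denom a n)"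
    unfolding of_nat_le_iff by (rule cf_denom_Suc_le[OF a])
  then have "ln (real (cf_denom a (Suc n))) \<le> ln ((real (a n) + 1) * real (cf_denom a n))"
    using q[of n] q[of "Suc n"] by (intro ln_mono) (auto simp: algebra_simps)
  also have "\<dots> = ln (real (a n) + 1) + ln (real (cf_denom a n))"
    using q[of n] by (simp add: ln_mult)
  finally show ?case using Suc by simp
qed simp

lemma cf_det:
  "int (cf_num a (Suc n)) * int (cf_denom a n) - int (cf_num a n) * int (cf_denom a (Suc n)) = (- 1) ^ n"
  by (induction n) (auto simp: algebra_simps)

lemma cf_coprime: "coprime (cf_num a n) (cf_denom a n)"
proof -
  have "coprime (int (cf_num a n)) (int (cf_denom a n))"
  proof (rule coprimeI)
    fix c assume c: "c dvd int (cf_num a n)" "c dvd int (cf_denom a n)"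
    then have "c dvd (- 1) ^ n"
      unfolding cf_det[of a n, symmetric] by (intro dvd_diff) auto
    then show "is_unit c" by (metis dvd_trans dvd_mult2 minus_one_mult_self dvd_triv_left mult.commute power_mult_distrib)
  qed
  then show ?thesis by simp
qed

text \<open>This product over the Gauss orbit is |q_n x - p_n|. As a product it is visibly positive,
  and the digit equation of the orbit turns it into a three-term recursion.\<close>

definition cf_tail_prod :: "real \<Rightarrow> nat \<Rightarrow> real" where
  "cf_tail_prod x n = (\<Prod>k\<le>n. (gauss_map ^^ k) x)"

context
  fixes x :: real
  assumes x: "x \<in> irrational_unit"
begin

abbreviation "cfa \<equiv> cf_digit x"
abbreviation "cfq \<equiv> cf_denom (cf_digit x)"
abbreviation "cfp \<equiv> cf_num (cf_digit x)"
abbreviation "cfD \<equiv> cf_tail_prod x"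

lemma cf_tail_prod_pos: "cfD n > 0"
  unfolding cf_tail_prod_def
  by (intro prod_pos) (use irrational_unitD(1)[OF funpow_gauss_map_irrational_unit[OF x]] in auto)

lemma cf_tail_prod_Suc: "cfD (Suc n) = cfD n * (gauss_map ^^ Suc n) x"
  by (simp add: cf_tail_prod_def)

lemma cf_digit_inverse: "real (cfa n) + (gauss_map ^^ Suc n) x = 1 / (gauss_map ^^ n) x"
  unfolding cf_digit_def
  using digit_plus_gauss_map[of "(gauss_map ^^ n) x"]
    irrational_unitD(1)[OF funpow_gauss_map_irrational_unit[OF x]] by simp

lemma cf_tail_prod_rec: "cfD (Suc (Suc n)) = cfD n - real (cfa (Suc n)) * cfD (Suc n)"
proof -
  have "(gauss_map ^^ Suc n) x > 0"
    using irrational_unitD(1)[OF funpow_gauss_map_irrational_unit[OF x]] .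
  then have "cfD n = cfD (Suc n) * (1 / (gauss_map ^^ Suc n) x)"
    by (simp add: cf_tail_prod_Suc del: funpow.simps)
  also have "\<dots> = cfD (Suc n) * (real (cfa (Suc n)) + (gauss_map ^^ Suc (Suc n)) x)"
    by (simp only: cf_digit_inverse)
  finally show ?thesis
    by (simp add: cf_tail_prod_Suc[of "Suc n"] algebra_simps del: funpow.simps)
qed

lemma cf_tail_prod_1: "cfD (Suc 0) = 1 - real (cfa 0) * x"
proof -
  have "x * (real (cfa 0) + gauss_map x) = 1"
    using cf_digit_inverse[of 0] irrational_unitD(1)[OF x] by simp
  then show ?thesis by (simp add: cf_tail_prod_def algebra_simps)
qed

text \<open>In the induction step the two digit terms cancel, so the left side does not depend on n.
  The identity traps \<open>cfD n\<close> between 1/(q_(n+1) + q_n) and 1/q_(n+1).\<close>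

lemma cf_denom_tail_prod: "real (cfq (Suc n)) * cfD n + real (cfq n) * cfD (Suc n) = 1"
proof (induction n)
  case 0
  then show ?case using cf_tail_prod_1 by (simp add: cf_tail_prod_def)
next
  case (Suc n)
  then show ?case by (simp add: cf_tail_prod_rec algebra_simps)
qed

lemma cf_convergent_error: "real (cfq n) * x - real (cfp n) = (- 1) ^ n * cfD n"
proof (induction n rule: induct_nat_012)
  case 0
  then show ?case by (simp add: cf_tail_prod_def)
next
  case 1
  then show ?case by (simp add: cf_tail_prod_1)
next
  case (ge2 n)
  then have 1: "real (cfq (Suc n)) * x = real (cfp (Suc n)) + (- 1) ^ Suc n * cfD (Suc n)"
    and 2: "real (cfq n) * x = real (cfp n) + (- 1) ^ n * cfD n" by simp_all
  have "real (cfq (Suc (Suc n))) * x - real (cfp (Suc (Suc n)))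
    = real (cfa (Suc n)) * (real (cfq (Suc n)) * x - real (cfp (Suc n))) + (real (cfq n) * x - real (cfp n))"
    by (simp add: algebra_simps)
  also have "\<dots> = (- 1) ^ Suc (Suc n) * cfD (Suc (Suc n))"
    unfolding 1 2 cf_tail_prod_rec by (simp add: algebra_simps)
  finally show ?case .
qed

lemmas cfq_pos = cf_denom_pos[of "cf_digit x", OF cf_digit_pos[OF x]]

lemma cf_tail_prod_le: "cfD n \<le> 1 / real (cfq (Suc n))"
proof -
  have "real (cfq (Suc n)) * cfD n \<le> 1"
    using cf_denom_tail_prod[of n] cf_tail_prod_pos[of "Suc n"] by (smt (verit) mult_nonneg_nonneg of_nat_0_le_iff)
  then show ?thesis using cfq_pos[of "Suc n"] by (simp add: field_simps)
qed

lemma cf_tail_prod_ge: "1 / (real (cfq (Suc n)) + real (cfq n)) \<le> cfD n"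
proof -
  have "cfD (Suc n) \<le> cfD n"
    using cf_tail_prod_pos[of n] irrational_unitD(2)[OF funpow_gauss_map_irrational_unit[OF x, of "Suc n"]]
    by (simp add: cf_tail_prod_Suc mult_left_le)
  then have "real (cfq n) * cfD (Suc n) \<le> real (cfq n) * cfD n"
    by (rule mult_left_mono) simp
  then have "1 \<le> (real (cfq (Suc n)) + real (cfq n)) * cfD n"
    using cf_denom_tail_prod[of n] by (simp add: algebra_simps)
  then show ?thesis using cfq_pos[of "Suc n"] by (simp add: field_simps)
qed

lemma cf_convergent_dist: "\<bar>x - real (cfp n) / real (cfq n)\<bar> = cfD n / real (cfq n)"
proof -
  have "x - real (cfp n) / real (cfq n) = (real (cfq n) * x - real (cfp n)) / real (cfq n)"
    using cfq_pos[of n] by (simp add: field_simps)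
  then show ?thesis
    using cf_tail_prod_pos[of n] by (simp add: cf_convergent_error abs_mult)
qed

lemma cfq_tendsto: "filterlim (\<lambda>n. real (cfq n)) at_top sequentially"
proof (rule filterlim_at_top_mono)
  have "filterlim (\<lambda>n. sqrt (2 ^ n / 2) :: real) at_top sequentially"
    by (rule filterlim_compose[OF sqrt_at_top]) real_asymp
  then show "filterlim (\<lambda>n. sqrt (2 ^ n / 2) :: real) at_top sequentially" .
  show "\<forall>\<^sub>F n in sequentially. sqrt (2 ^ n / 2) \<le> real (cfq n)"
  proof (intro always_eventually allI)
    fix n
    have "real (2 ^ n) \<le> real (2 * (cfq n)\<^sup>2)"
      using cf_denom_exponential[of "cf_digit x" n, OF cf_digit_pos[OF x]] by (simp only: of_nat_le_iff)
    then show "sqrt (2 ^ n / 2) \<le> real (cfq n)"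
      by (intro real_le_lsqrt) auto
  qed
qed

section \<open>From digit growth to the irrationality exponent\<close>

lemma cfq_straddle:
  fixes Q :: nat
  assumes "Q \<ge> 1"
  obtains n where "cfq n \<le> Q" "Q < cfq (Suc n)"
proof -
  have "\<exists>n. real Q < real (cfq n)"
    using cfq_tendsto by (metis eventually_happens filterlim_at_top_dense trivial_limit_sequentially)
  then have ex: "\<exists>n. Q < cfq n" by simp
  define m where "m = (LEAST n. Q < cfq n)"
  have m: "Q < cfq m" unfolding m_def using ex by (rule LeastI_ex)
  then have "m \<noteq> 0" using assms by (cases m) auto
  then obtain n where n: "m = Suc n" by (cases m) auto
  have "\<not> Q < cfq n" using not_less_Least[of n "\<lambda>n. Q < cfq n"] n unfolding m_def by simp
  then show thesis using that[of n] m n by simp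
qed

text \<open>If p/q equals a suitable convergent p_n/q_n, its error is bounded below through a_n <=
  q_n^t. Otherwise the two fractions are at least 1/(q q_n) apart while x is within half of that
  distance of the convergent, so x stays away from p/q. The fraction p/q need not be in lowest
  terms.\<close>

lemma badly_approximable_if_digits_le:
  assumes t: "t > 0" and ev: "\<forall>\<^sub>F n in sequentially. ln (real (cfa n)) \<le> t * ln (real (cfq n))"
  shows "badly_approximable (2 + t) x"
proof -
  obtain N where N: "\<And>n. n \<ge> N \<Longrightarrow> ln (real (cfa n)) \<le> t * ln (real (cfq n))"
    using ev by (auto simp: eventually_sequentially)
  \<comment> \<open>The constant 1/4 serves both cases: q_(n+1) + q_n <= (a_n + 2) q_n <= 3 a_n q_n
    in the first, and 1/(2 q q_n) with q_n <= 2 q in the second.\<close>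
  have *: "(MIN p\<in>{0..q}. \<bar>x - real p / real q\<bar>) \<ge> (1/4) / real q powr (2 + t)"
    if q: "q \<ge> cfq N" for q
  proof -
    have q1: "q \<ge> 1" using q cfq_pos[of N] by linarith
    \<comment> \<open>Straddling 2 q instead of q gives q_(n+1) > 2 q, hence a convergent error of
      at most half the separation 1/(q q_n).\<close>
    obtain n where n: "cfq n \<le> 2 * q" "2 * q < cfq (Suc n)"
      using cfq_straddle[of "2 * q"] q1 by auto
    have "n \<ge> N"
    proof (rule ccontr)
      assume "\<not> n \<ge> N"
      then have "cfq (Suc n) \<le> cfq N"
        by (intro cf_denom_mono[OF cf_digit_pos[OF x]]) simp
      then show False using n q by linarith
    qed
    note cq = cfq_pos[of n]
    have aq: "real (cfa n) \<le> real (cfq n) powr t"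
    proof -
      have "real (cfa n) = exp (ln (real (cfa n)))" using cf_digit_pos[OF x, of n] by simp
      also have "\<dots> \<le> exp (t * ln (real (cfq n)))" using N[OF \<open>n \<ge> N\<close>] by simp
      finally show ?thesis using cq by (simp add: powr_def)
    qed
    have "(1/4) / real q powr (2 + t) \<le> \<bar>x - real p / real q\<bar>" for p
    proof (cases "p * cfq n = cfp n * q")
      case True
      then have "cfq n dvd cfp n * q" by (metis dvd_triv_right)
      then have "cfq n dvd q"
        using cf_coprime[of "cf_digit x" n] by (metis coprime_commute coprime_dvd_mult_right_iff)
      then have le: "cfq n \<le> q" using q1 by (intro dvd_imp_le) auto
      have "real p * real (cfq n) = real (cfp n) * real q" using True by (metis of_nat_mult)
      then have eq: "real p / real q = real (cfp n) / real (cfq n)"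
        using q1 cq by (simp add: field_simps)
      have "real (cfq (Suc n)) \<le> real ((cfa n + 1) * cfq n)"
        using cf_denom_Suc_le[of "cf_digit x" n, OF cf_digit_pos[OF x]] by (simp only: of_nat_le_iff)
      then have "real (cfq (Suc n)) + real (cfq n) \<le> (real (cfa n) + 2) * real (cfq n)"
        by (simp add: algebra_simps)
      also have "\<dots> \<le> (3 * real (cfa n)) * real (cfq n)"
        using cf_digit_pos[OF x, of n] by (intro mult_right_mono) auto
      also have "\<dots> \<le> (4 * real (cfq n) powr t) * real (cfq n)"
        using aq by (intro mult_right_mono) auto
      finally have A: "real (cfq (Suc n)) + real (cfq n) \<le> 4 * real (cfq n) powr (1 + t)"
        using cq by (simp add: powr_add mult_ac)
      have "(1/4) / real q powr (2 + t) \<le> (1/4) / real (cfq n) powr (2 + t)"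
        using le cq t by (intro divide_left_mono powr_mono2 mult_pos_pos) auto
      also have "\<dots> = (1 / (4 * real (cfq n) powr (1 + t))) / real (cfq n)"
        using cq by (simp add: powr_add power2_eq_square)
      also have "\<dots> \<le> (1 / (real (cfq (Suc n)) + real (cfq n))) / real (cfq n)"
        using A cq by (intro divide_right_mono divide_left_mono mult_pos_pos) auto
      also have "\<dots> \<le> cfD n / real (cfq n)"
        using cf_tail_prod_ge by (intro divide_right_mono) auto
      also have "\<dots> = \<bar>x - real p / real q\<bar>" by (simp add: eq cf_convergent_dist)
      finally show ?thesis .
    next
      case False
      have pos: "real q > 0" "real (cfq n) > 0" using q1 cq by auto
      have "int p * int (cfq n) \<noteq> int (cfp n) * int q" using False by (metis of_nat_eq_iff of_nat_mult)
      then have "\<bar>int p * int (cfq n) - int (cfp n) * int q\<bar> \<ge> 1" by linarith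
      then have "real_of_int 1 \<le> real_of_int \<bar>int p * int (cfq n) - int (cfp n) * int q\<bar>"
        by (simp only: of_int_le_iff)
      then have "\<bar>real p * real (cfq n) - real (cfp n) * real q\<bar> \<ge> 1" by simp
      then have "1 / (real q * real (cfq n)) \<le> \<bar>real p * real (cfq n) - real (cfp n) * real q\<bar> / (real q * real (cfq n))"
        using pos by (intro divide_right_mono) auto
      also have "\<dots> = \<bar>(real p * real (cfq n) - real (cfp n) * real q) / (real q * real (cfq n))\<bar>"
        using pos by (simp add: abs_divide)
      also have "(real p * real (cfq n) - real (cfp n) * real q) / (real q * real (cfq n))
          = real p / real q - real (cfp n) / real (cfq n)"
        using pos by (simp add: field_simps)
      finally have 1: "1 / (real q * real (cfq n)) \<le> \<bar>real p / real q - real (cfp n) / real (cfq n)\<bar>" .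
      have "\<bar>x - real (cfp n) / real (cfq n)\<bar> \<le> (1 / real (cfq (Suc n))) / real (cfq n)"
        unfolding cf_convergent_dist using cf_tail_prod_le by (intro divide_right_mono) auto
      also have "\<dots> \<le> (1 / (2 * real q)) / real (cfq n)"
        using n(2) pos by (intro divide_right_mono divide_left_mono mult_pos_pos) (auto simp: of_nat_less_iff[symmetric] simp del: of_nat_less_iff)
      finally have 2: "\<bar>x - real (cfp n) / real (cfq n)\<bar> \<le> 1 / (real q * real (cfq n)) / 2" by simp
      have "(1/4) / real q powr (2 + t) \<le> (1/4) / real q powr 2"
        using q1 t by (intro divide_left_mono powr_mono mult_pos_pos) auto
      also have "\<dots> = 1 / (real q * (2 * real q)) / 2" using pos by (simp add: power2_eq_square)
      also have "\<dots> \<le> 1 / (real q * real (cfq n)) / 2"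
        using n(1) pos by (intro divide_right_mono divide_left_mono mult_left_mono mult_pos_pos) auto
      finally have 3: "(1/4) / real q powr (2 + t) \<le> 1 / (real q * real (cfq n)) / 2" .
      define D where "D = 1 / (real q * real (cfq n))"
      show ?thesis using 1 2 3 unfolding D_def[symmetric] by linarith
    qed
    then show ?thesis by (intro Min.boundedI) auto
  qed
  show ?thesis
    unfolding badly_approximable_def
    by (intro exI[of _ "1/4"] conjI eventually_sequentiallyI[of "cfq N"] *) auto
qed

lemma irrationality_exponent_le:
  assumes "r \<ge> 0" and "\<And>t. t > r \<Longrightarrow> \<forall>\<^sub>F n in sequentially. ln (real (cfa n)) \<le> t * ln (real (cfq n))"
  shows "irrationality_exponent x \<le> ereal (2 + r)"
proof (rule ereal_le_epsilon2)
  fix e :: real assume "e > 0"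
  then have "badly_approximable (2 + (r + e)) x"
    using assms by (intro badly_approximable_if_digits_le) auto
  then have "irrationality_exponent x \<le> ereal (2 + (r + e))"
    unfolding irrationality_exponent_def using assms(1) \<open>e > 0\<close> by (intro INF_lower) auto
  then show "irrationality_exponent x \<le> ereal (2 + r) + ereal e" by (simp add: add.assoc)
qed

text \<open>Every convergent has p_n <= q_n and so competes in the minimum; along the given indices
  its error is at most 1/(q_n q_(n+1)) <= q_n^-(2+t). If x were s-BA with s < 2 + t, the constant c
  would be at most q_n^(s-2-t), which tends to 0.\<close>

lemma irrationality_exponent_ge:
  assumes t: "t \<ge> 0" and io: "\<exists>\<^sub>F n in sequentially. t * ln (real (cfq n)) \<le> ln (real (cfa n))"
  shows "ereal (2 + t) \<le> irrationality_exponent x"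
  unfolding irrationality_exponent_def
proof (rule INF_greatest)
  fix s assume "s \<in> {s. s > 0 \<and> badly_approximable s x}"
  then obtain c where c: "c > 0"
    and ev: "\<forall>\<^sub>F q::nat in sequentially. (MIN p\<in>{0..q}. \<bar>x - real p / real q\<bar>) \<ge> c / real q powr s"
    by (auto simp: badly_approximable_def)
  have "filterlim cfq at_top sequentially"
    using cfq_tendsto by (simp add: filterlim_sequentially_iff_filterlim_real)
  from eventually_compose_filterlim[OF ev this]
  have ev': "\<forall>\<^sub>F n in sequentially. (MIN p\<in>{0..cfq n}. \<bar>x - real p / real (cfq n)\<bar>) \<ge> c / real (cfq n) powr s" .
  show "ereal (2 + t) \<le> ereal s"
  proof (rule ccontr)
    assume "\<not> ?thesis"
    then have st: "s - (2 + t) < 0" by simp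
    have "((\<lambda>n. real (cfq n) powr (s - (2 + t))) \<longlongrightarrow> 0) sequentially"
      by (rule tendsto_neg_powr[OF st cfq_tendsto])
    then have ev2: "\<forall>\<^sub>F n in sequentially. real (cfq n) powr (s - (2 + t)) < c"
      using c by (rule order_tendstoD)
    have "\<exists>\<^sub>F n in sequentially. False"
      using frequently_eventually_frequently[OF io eventually_conj[OF ev' ev2]]
    proof (rule frequently_elim1)
      fix n assume n: "t * ln (real (cfq n)) \<le> ln (real (cfa n)) \<and>
        c / real (cfq n) powr s \<le> (MIN p\<in>{0..cfq n}. \<bar>x - real p / real (cfq n)\<bar>) \<and>
        real (cfq n) powr (s - (2 + t)) < c"
      have pos: "real (cfq n) > 0" "real (cfa n) > 0"
        using cfq_pos[of n] cf_digit_pos[OF x, of n] by auto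
      have "t * ln (real (cfq n)) \<le> ln (real (cfa n))" using n by blast
      then have "exp (t * ln (real (cfq n))) \<le> exp (ln (real (cfa n)))"
        by (simp only: exp_le_cancel_iff)
      moreover have "real (cfq n) powr t = exp (t * ln (real (cfq n)))"
        unfolding powr_def using pos(1) by (intro if_not_P) simp
      ultimately have qa: "real (cfq n) powr t \<le> real (cfa n)"
        by (simp only: exp_ln[OF pos(2)])
      have "real (cfa n) * real (cfq n) \<le> real (cfq (Suc n))"
        unfolding of_nat_mult[symmetric] of_nat_le_iff
        by (rule cf_denom_Suc_ge[OF cf_digit_pos[OF x]])
      then have *: "real (cfq n) powr t * real (cfq n) \<le> real (cfq (Suc n))"
        using mult_right_mono[OF qa, of "real (cfq n)"] by simp
      have "c / real (cfq n) powr s \<le> (MIN p\<in>{0..cfq n}. \<bar>x - real p / real (cfq n)\<bar>)"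
        using n by blast
      also have "\<dots> \<le> \<bar>x - real (cfp n) / real (cfq n)\<bar>"
        using cf_num_le_denom[of "cf_digit x" n, OF cf_digit_pos[OF x]] by (intro Min_le) auto
      also have "\<dots> \<le> 1 / real (cfq (Suc n)) / real (cfq n)"
        unfolding cf_convergent_dist using cf_tail_prod_le by (intro divide_right_mono) auto
      also have "\<dots> \<le> 1 / (real (cfq n) powr t * real (cfq n)) / real (cfq n)"
        using pos cfq_pos[of "Suc n"] * by (intro divide_right_mono divide_left_mono mult_pos_pos) auto
      also have "\<dots> = 1 / real (cfq n) powr (2 + t)"
        using pos by (simp add: powr_add power2_eq_square)
      finally have "c \<le> real (cfq n) powr s / real (cfq n) powr (2 + t)"
        using pos(1) by (subst (asm) pos_divide_le_eq) auto
      moreover have "real (cfq n) powr (s - (2 + t)) < c" using n by blast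
      ultimately show False by (simp add: powr_diff)
    qed
    then show False by simp
  qed
qed

text \<open>The case t = 0, where the digit condition holds at every index because digits are at
  least 1. This is Dirichlet's bound.\<close>

lemma irrationality_exponent_ge_2: "2 \<le> irrationality_exponent x"
  using irrationality_exponent_ge[of 0] cf_digit_pos[OF x] by simp

lemma liouville_if_digits_ge:
  assumes "\<And>K::nat. \<exists>\<^sub>F n in sequentially. real K * ln (real (cfq n)) \<le> ln (real (cfa n))"
  shows "liouville x"
proof -
  have "ereal (real K) \<le> irrationality_exponent x" for K :: nat
    using irrationality_exponent_ge[OF _ assms, of K] by (rule order_trans[rotated]) auto
  then have "ereal B \<le> irrationality_exponent x" for B
    using real_arch_simple[of B] by (meson ereal_less_eq(3) order_trans)
  then show ?thesis unfolding liouville_def by (intro ereal_top)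
qed

end

section \<open>A Kochen-Stone lemma and mixing processes\<close>

text \<open>A quadratic minorant of the indicator takes the place of Cauchy-Schwarz: (Z/l - 1)^2 >=
  0 gives 2 Z/l - Z^2/l^2 <= 1 on the union, and the left side vanishes off it.\<close>

lemma (in prob_space) second_moment_union_bound:
  fixes A :: "nat \<Rightarrow> 'a set"
  assumes A[measurable]: "\<And>n. A n \<in> events" and I: "finite I"
    and D: "D > 0" and s: "(\<Sum>n\<in>I. prob (A n)) > 0"
    and le: "(\<Sum>m\<in>I. \<Sum>n\<in>I. prob (A m \<inter> A n)) \<le> D * (\<Sum>n\<in>I. prob (A n))\<^sup>2"
  shows "1 / D \<le> prob (\<Union>n\<in>I. A n)"
proof -
  define s where "s = (\<Sum>n\<in>I. prob (A n))"
  define Z :: "'a \<Rightarrow> real" where "Z \<omega> = (\<Sum>n\<in>I. indicator (A n) \<omega>)" for \<omega>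
  define U where "U = (\<Union>n\<in>I. A n)"
  have U[measurable]: "U \<in> events" unfolding U_def using I by auto
  have int: "integrable M (\<lambda>\<omega>. indicator B \<omega> :: real)" if "B \<in> events" for B
    using that by (simp add: integrable_indicator_iff emeasure_eq_measure)
  have Zi: "integrable M Z" unfolding Z_def by (intro Bochner_Integration.integrable_sum int) simp
  have EZ: "expectation Z = s" unfolding Z_def s_def
    by (subst Bochner_Integration.integral_sum) (auto intro!: int)
  have Z2: "(Z \<omega>)\<^sup>2 = (\<Sum>m\<in>I. \<Sum>n\<in>I. indicator (A m \<inter> A n) \<omega>)" for \<omega>
    unfolding Z_def power2_eq_square sum_product by (simp add: indicator_inter_arith)
  have Z2i: "integrable M (\<lambda>\<omega>. (Z \<omega>)\<^sup>2)"
    unfolding Z2 by (intro Bochner_Integration.integrable_sum int) simp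
  have EZ2: "expectation (\<lambda>\<omega>. (Z \<omega>)\<^sup>2) = (\<Sum>m\<in>I. \<Sum>n\<in>I. prob (A m \<inter> A n))"
    unfolding Z2 by (subst Bochner_Integration.integral_sum, fastforce intro!: int)+ (auto simp: measure_def)
  \<comment> \<open>The choice l = D s maximises 2 s/l - D s^2/l^2; the maximum is 1/D.\<close>
  define l where "l = D * s"
  have l: "l > 0" using D s by (simp add: l_def s_def)
  have pw: "2 * Z \<omega> / l - (Z \<omega>)\<^sup>2 / l\<^sup>2 \<le> indicator U \<omega>" for \<omega>
  proof (cases "\<omega> \<in> U")
    case True
    have "0 \<le> (Z \<omega> / l - 1)\<^sup>2" by simp
    then show ?thesis using True by (simp add: power2_eq_square algebra_simps)
  next
    case False
    then have "Z \<omega> = 0" unfolding Z_def U_def by (intro sum.neutral) auto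
    then show ?thesis by simp
  qed
  have "2 * s / l - expectation (\<lambda>\<omega>. (Z \<omega>)\<^sup>2) / l\<^sup>2 = expectation (\<lambda>\<omega>. 2 * Z \<omega> / l - (Z \<omega>)\<^sup>2 / l\<^sup>2)"
    using Zi Z2i by (simp add: EZ)
  also have "\<dots> \<le> expectation (indicator U)"
    using pw by (intro integral_mono int) (use Zi Z2i in auto)
  also have "\<dots> = prob U" by (simp add: measure_def)
  finally have 1: "2 * s / l - expectation (\<lambda>\<omega>. (Z \<omega>)\<^sup>2) / l\<^sup>2 \<le> prob U" .
  have "expectation (\<lambda>\<omega>. (Z \<omega>)\<^sup>2) / l\<^sup>2 \<le> (D * s\<^sup>2) / l\<^sup>2"
    using le unfolding EZ2 s_def by (intro divide_right_mono) auto
  also have "\<dots> = 1 / D" using D s by (simp add: l_def s_def power2_eq_square)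
  finally have 2: "expectation (\<lambda>\<omega>. (Z \<omega>)\<^sup>2) / l\<^sup>2 \<le> 1 / D" .
  have 3: "2 * s / l = 2 * (1 / D)" using D s by (simp add: l_def s_def)
  show ?thesis using 1 2 3 unfolding U_def by linarith
qed

text \<open>The hypothesis compares with the event of index n - m - b, which may lie below j. The
  inner sums are therefore controlled by the partial sum \<open>s0\<close> from 0 and not by the sum
  \<open>s\<close> over the block from j; the block is taken so long that this costs only a factor
  2. The final constant depends neither on j nor on b.\<close>

lemma (in prob_space) kochen_stone_renewal:
  fixes A :: "nat \<Rightarrow> 'a set"
  assumes A[measurable]: "\<And>n. A n \<in> events" and C: "C \<ge> 0"
    and le: "\<And>m n. m + b \<le> n \<Longrightarrow> prob (A m \<inter> A n) \<le> C * prob (A m) * prob (A (n - m - b))"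
    and div: "\<not> summable (\<lambda>n. prob (A n))"
  shows "1 / (2 + 4 * C) \<le> prob (\<Union>n\<in>{j..}. A n)"
proof -
  define a where "a n = prob (A n)" for n
  have a0: "a n \<ge> 0" for n by (simp add: a_def)
  define B where "B = (\<Sum>n<j. a n)"
  \<comment> \<open>This size makes the block sum s = s0 - B exceed both B and b. The former gives
    s0 <= 2 s, the latter bounds the b terms next to the diagonal by \<open>s * a m\<close>.\<close>
  have "\<exists>L. (\<Sum>n<L. a n) > 2 * B + real b + 1"
  proof (rule ccontr)
    assume "\<not> ?thesis"
    then have "(\<Sum>n<L. a n) \<le> 2 * B + real b + 1" for L by (simp add: not_less)
    then have "summable a" using a0 by (intro summableI_nonneg_bounded)
    then show False using div unfolding a_def by simp
  qed
  then obtain L where L: "(\<Sum>n<L. a n) > 2 * B + real b + 1" by blast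
  have B0: "B \<ge> 0" unfolding B_def using a0 by (simp add: sum_nonneg)
  define I where "I = {j..<L}"
  define s where "s = (\<Sum>n\<in>I. a n)"
  define s0 where "s0 = (\<Sum>n<L. a n)"
  have "j \<le> L"
  proof (rule ccontr)
    assume "\<not> j \<le> L"
    then have "(\<Sum>n<L. a n) \<le> B" unfolding B_def using a0 by (intro sum_mono2) auto
    then show False using L B0 by linarith
  qed
  then have s0: "s0 = B + s"
    unfolding s0_def B_def s_def I_def
    using sum.atLeastLessThan_concat[of 0 j L a] by (simp add: atLeast0LessThan)
  have s: "s \<ge> B" "s \<ge> real b" "s > 0" using L B0 s0 unfolding s0_def[symmetric] by linarith+
  have a_inter: "prob (A m \<inter> A n) \<le> a m" for m n unfolding a_def by (intro finite_measure_mono) auto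
  have inner: "(\<Sum>n\<in>{n\<in>I. m \<le> n}. prob (A m \<inter> A n)) \<le> a m * (s + 2 * C * s)" for m
  proof -
    have "(\<Sum>n\<in>{n\<in>I. m \<le> n}. prob (A m \<inter> A n)) \<le> (\<Sum>n\<in>{m..<m+b} \<union> {n\<in>I. m + b \<le> n}. prob (A m \<inter> A n))"
      by (intro sum_mono2) (auto simp: I_def)
    also have "\<dots> = (\<Sum>n\<in>{m..<m+b}. prob (A m \<inter> A n)) + (\<Sum>n\<in>{n\<in>I. m + b \<le> n}. prob (A m \<inter> A n))"
      by (intro sum.union_disjoint) (auto simp: I_def)
    also have "\<dots> \<le> (\<Sum>n\<in>{m..<m+b}. a m) + (\<Sum>n\<in>{n\<in>I. m + b \<le> n}. C * a m * a (n - m - b))"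
      using le a_inter by (intro add_mono sum_mono) (auto simp: a_def)
    also have "(\<Sum>n\<in>{m..<m+b}. a m) = real b * a m" by simp
    also have "(\<Sum>n\<in>{n\<in>I. m + b \<le> n}. C * a m * a (n - m - b)) = C * a m * (\<Sum>n\<in>{n\<in>I. m + b \<le> n}. a (n - m - b))"
      by (simp add: sum_distrib_left)
    also have "(\<Sum>n\<in>{n\<in>I. m + b \<le> n}. a (n - m - b)) = (\<Sum>n\<in>(\<lambda>n. n - m - b) ` {n\<in>I. m + b \<le> n}. a n)"
      by (subst sum.reindex) (auto simp: inj_on_def)
    also have "C * a m * \<dots> \<le> C * a m * s0"
      unfolding s0_def using C a0 by (intro mult_left_mono sum_mono2) (auto simp: I_def)
    also have "\<dots> \<le> C * a m * (2 * s)" using s s0 C a0 by (intro mult_left_mono) auto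
    also have "real b * a m \<le> s * a m" using s a0 by (intro mult_right_mono) auto
    finally show ?thesis by (simp add: algebra_simps)
  qed
  define P where "P m n = prob (A m \<inter> A n)" for m n
  have P: "P m n = P n m" "P m n \<ge> 0" for m n by (auto simp: P_def Int_commute)
  have fin: "finite I" by (simp add: I_def)
  \<comment> \<open>Symmetrising counts the diagonal twice, which is harmless for an upper bound,
    and doubles 1 + 2 C to the constant 2 + 4 C.\<close>
  have "(\<Sum>m\<in>I. \<Sum>n\<in>I. P m n) \<le> (\<Sum>m\<in>I. \<Sum>n\<in>I. (if m \<le> n then P m n else 0) + (if n \<le> m then P n m else 0))"
    using P by (intro sum_mono) auto
  also have "\<dots> = (\<Sum>m\<in>I. \<Sum>n\<in>I. if m \<le> n then P m n else 0) + (\<Sum>m\<in>I. \<Sum>n\<in>I. if n \<le> m then P n m else 0)"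
    by (simp add: sum.distrib)
  also have "(\<Sum>m\<in>I. \<Sum>n\<in>I. if n \<le> m then P n m else 0) = (\<Sum>m\<in>I. \<Sum>n\<in>I. if m \<le> n then P m n else 0)"
    by (rule sum.swap)
  also have "(\<Sum>m\<in>I. \<Sum>n\<in>I. if m \<le> n then P m n else 0) = (\<Sum>m\<in>I. \<Sum>n\<in>{n\<in>I. m \<le> n}. P m n)"
    by (simp only: sum.inter_filter[OF fin])
  also have "\<dots> \<le> (\<Sum>m\<in>I. a m * (s + 2 * C * s))"
    unfolding P_def by (intro sum_mono inner)
  also have "\<dots> = s * (s + 2 * C * s)" by (simp add: s_def sum_distrib_right)
  finally have "(\<Sum>m\<in>I. \<Sum>n\<in>I. P m n) \<le> (2 + 4 * C) * s\<^sup>2"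
    by (simp add: algebra_simps power2_eq_square)
  then have "1 / (2 + 4 * C) \<le> prob (\<Union>n\<in>I. A n)"
    using C s fin unfolding P_def s_def a_def by (intro second_moment_union_bound) auto
  also have "\<dots> \<le> prob (\<Union>n\<in>{j..}. A n)"
    by (intro finite_measure_mono sets.countable_UN) (auto simp: I_def)
  finally show ?thesis .
qed

section \<open>Stationary processes over a general space and the zero-one law under mixing\<close>

definition process_algebra :: "'a set \<Rightarrow> ('a \<Rightarrow> 'a) \<Rightarrow> ('a \<Rightarrow> nat) \<Rightarrow> nat set \<Rightarrow> 'a set set" where
  "process_algebra \<Omega> T Y K = sigma_sets \<Omega> (\<Union>k\<in>K. {(Y \<circ> T ^^ k) -` S \<inter> \<Omega> | S. True})"

locale stationary_process = prob_space M for M :: "'a measure" +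
  fixes T :: "'a \<Rightarrow> 'a" and Y :: "'a \<Rightarrow> nat"
  assumes T[measurable]: "T \<in> measurable M M"
    and T_invariant: "distr M M T = M"
    and Y[measurable]: "Y \<in> measurable M (count_space UNIV)"
begin

lemma funpow_T[measurable]: "T ^^ n \<in> measurable M M"
  by (induction n) auto

lemma funpow_T_space: "\<omega> \<in> space M \<Longrightarrow> (T ^^ n) \<omega> \<in> space M"
  using measurable_space[OF funpow_T] .

lemma funpow_T_invariant: "distr M M (T ^^ n) = M"
proof (induction n)
  case (Suc n)
  have "distr M M (T ^^ Suc n) = distr (distr M M (T ^^ n)) M T"
    by (subst distr_distr) (simp_all only: T funpow_T funpow.simps)
  then show ?case by (simp only: Suc.IH T_invariant)
qed (simp add: distr_id2 id_def)

lemma prob_funpow_vimage: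
  assumes "A \<in> events"
  shows "prob ((T ^^ n) -` A \<inter> space M) = prob A"
  using measure_distr[OF funpow_T[of n] assms] by (simp add: funpow_T_invariant)

lemma prob_funpow_Collect:
  assumes "{\<omega> \<in> space M. P \<omega>} \<in> events"
  shows "prob {\<omega> \<in> space M. P ((T ^^ n) \<omega>)} = prob {\<omega> \<in> space M. P \<omega>}"
proof -
  have "{\<omega> \<in> space M. P ((T ^^ n) \<omega>)} = (T ^^ n) -` {\<omega> \<in> space M. P \<omega>} \<inter> space M"
    using funpow_T_space by auto
  then show ?thesis using prob_funpow_vimage[OF assms] by simp
qed

lemma expectation_funpow:
  fixes f :: "'a \<Rightarrow> real"
  assumes [measurable]: "f \<in> borel_measurable M"
  shows "expectation (\<lambda>\<omega>. f ((T ^^ n) \<omega>)) = expectation f"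
  using integral_distr[OF funpow_T[of n] assms] by (simp add: funpow_T_invariant)

abbreviation "\<F> \<equiv> process_algebra (space M) T Y"

text \<open>With \<open>\<F> K\<close> carried by a measure space, membership of an event in it
  becomes a measurability goal.\<close>

definition "\<F>M K = sigma (space M) (\<Union>k\<in>K. {(Y \<circ> T ^^ k) -` S \<inter> space M | S. True})"

lemma space_\<F>M[simp]: "space (\<F>M K) = space M"
  unfolding \<F>M_def by (rule space_measure_of) auto

lemma sets_\<F>M[simp]: "sets (\<F>M K) = \<F> K"
  unfolding \<F>M_def process_algebra_def by (rule sets_measure_of) auto

lemma \<F>_subset: "\<F> K \<subseteq> events"
proof -
  have "(Y \<circ> T ^^ k) -` S \<inter> space M \<in> events" for k S
    by (rule measurable_sets[of _ _ "count_space UNIV"]) auto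
  then show ?thesis unfolding process_algebra_def by (intro sets.sigma_sets_subset) auto
qed

lemma \<F>_mono: "K \<subseteq> L \<Longrightarrow> \<F> K \<subseteq> \<F> L"
  unfolding process_algebra_def by (rule sigma_sets_mono') auto

lemma measurable_Y_\<F>M: "k \<in> K \<Longrightarrow> (\<lambda>\<omega>. Y ((T ^^ k) \<omega>)) \<in> measurable (\<F>M K) (count_space UNIV)"
  unfolding measurable_def by (auto simp: process_algebra_def comp_def intro!: sigma_sets.Basic)

lemma vimage_funpow_\<F>:
  assumes "B \<in> \<F> UNIV"
  shows "(T ^^ n) -` B \<inter> space M \<in> \<F> {n..}"
proof -
  have "T ^^ n \<in> measurable (\<F>M {n..}) (\<F>M UNIV)"
  proof (rule measurable_sigma_sets)
    show "sets (\<F>M UNIV) = sigma_sets (space M) (\<Union>k\<in>UNIV. {(Y \<circ> T ^^ k) -` S \<inter> space M | S. True})"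
      by (simp add: process_algebra_def)
    fix y assume "y \<in> (\<Union>k\<in>UNIV. {(Y \<circ> T ^^ k) -` S \<inter> space M | S. True})"
    then obtain k S where y: "y = (Y \<circ> T ^^ k) -` S \<inter> space M" by auto
    have "(T ^^ n) -` y \<inter> space (\<F>M {n..}) = (Y \<circ> T ^^ (k + n)) -` S \<inter> space M"
      using funpow_T_space unfolding y by (auto simp: funpow_add)
    moreover have "\<dots> \<in> \<F> {n..}"
      unfolding process_algebra_def by (rule sigma_sets.Basic) (auto intro!: bexI[of _ "k + n"])
    ultimately show "(T ^^ n) -` y \<inter> space (\<F>M {n..}) \<in> sets (\<F>M {n..})" by simp
  qed (use funpow_T_space in auto)
  from measurable_sets[OF this, of B] assms show ?thesis by simp
qed

end

locale mixing_process = stationary_process +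
  fixes \<theta> :: "nat \<Rightarrow> real"
  assumes theta_nonneg: "\<And>N. N \<ge> 1 \<Longrightarrow> \<theta> N \<ge> 0" and theta_tendsto: "\<theta> \<longlonglongrightarrow> 0"
    and mixing: "\<And>n N A B. n \<ge> 1 \<Longrightarrow> N \<ge> 1 \<Longrightarrow> A \<in> \<F> {0..n} \<Longrightarrow> B \<in> \<F> {n+N..} \<Longrightarrow>
      \<bar>prob (A \<inter> B) - prob A * prob B\<bar> \<le> \<theta> N * prob A * prob B"
begin

text \<open>An invariant event equals all its preimages, hence lies in \<open>\<F> {n..}\<close> for
  every n. Letting the gap tend to infinity in the mixing inequality makes it independent of every
  \<open>\<F> {0..n}\<close>. The union of these is intersection-stable and generates
  \<open>\<F> UNIV\<close>, so the event is independent of itself.\<close>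

lemma invariant_event_0_1:
  assumes E: "E \<in> \<F> UNIV" and inv: "\<And>\<omega>. \<omega> \<in> space M \<Longrightarrow> T \<omega> \<in> E \<longleftrightarrow> \<omega> \<in> E"
  shows "prob E = 0 \<or> prob E = 1"
proof -
  have Ev: "E \<in> events" using E \<F>_subset by auto
  have "(T ^^ n) \<omega> \<in> E \<longleftrightarrow> \<omega> \<in> E" if "\<omega> \<in> space M" for n \<omega>
    by (induction n) (use inv funpow_T_space that in auto)
  then have "(T ^^ n) -` E \<inter> space M = E" for n using sets.sets_into_space[OF Ev] by auto
  then have Etail: "E \<in> \<F> {n..}" for n using vimage_funpow_\<F>[OF E, of n] by simp
  have indep: "prob (A \<inter> E) = prob A * prob E" if A: "A \<in> \<F> {0..n}" "n \<ge> 1" for A n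
  proof -
    have "(\<lambda>N. \<theta> N * prob A * prob E) \<longlonglongrightarrow> 0 * prob A * prob E"
      by (intro tendsto_intros theta_tendsto)
    then have "\<bar>prob (A \<inter> E) - prob A * prob E\<bar> \<le> 0 * prob A * prob E"
      by (rule LIMSEQ_le_const) (use mixing[OF A(2) _ A(1) Etail] in blast)
    then show ?thesis by simp
  qed
  define G where "G = (\<Union>n\<in>{1..}. \<F> {0..n})"
  have "Int_stable G"
  proof (rule Int_stableI)
    fix a b assume "a \<in> G" "b \<in> G"
    then obtain m n where mn: "m \<ge> 1" "n \<ge> 1" "a \<in> \<F> {0..m}" "b \<in> \<F> {0..n}" by (auto simp: G_def)
    have "a \<in> sets (\<F>M {0..max m n})" "b \<in> sets (\<F>M {0..max m n})"
      using mn \<F>_mono[of "{0..m}" "{0..max m n}"] \<F>_mono[of "{0..n}" "{0..max m n}"] by auto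
    then have "a \<inter> b \<in> \<F> {0..max m n}" using sets.Int[of a "\<F>M {0..max m n}" b] by simp
    then show "a \<inter> b \<in> G" using mn by (auto simp: G_def intro!: bexI[of _ "max m n"])
  qed
  moreover have "indep_set G {E}"
    unfolding indep_sets2_eq using Ev \<F>_subset indep by (auto simp: G_def)
  ultimately have ind: "indep_set (sigma_sets (space M) G) (sigma_sets (space M) {E})"
    by (intro indep_set_sigma_sets) (auto simp: Int_stable_def)
  have "\<F> UNIV \<subseteq> sigma_sets (space M) G"
    unfolding process_algebra_def[of _ _ _ UNIV]
  proof (rule sigma_sets_mono')
    show "(\<Union>k\<in>UNIV. {(Y \<circ> T ^^ k) -` S \<inter> space M | S. True}) \<subseteq> G"
    proof clarify
      fix k S
      have "(Y \<circ> T ^^ k) -` S \<inter> space M \<in> \<F> {0..Suc k}"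
        unfolding process_algebra_def by (rule sigma_sets.Basic) (auto intro!: bexI[of _ k])
      then show "(Y \<circ> T ^^ k) -` S \<inter> space M \<in> G" by (auto simp: G_def)
    qed
  qed
  then have "E \<in> sigma_sets (space M) G" using E by auto
  then have "prob (E \<inter> E) = prob E * prob E"
    using ind sigma_sets.Basic[of E "{E}" "space M"] unfolding indep_sets2_eq by blast
  then show ?thesis by simp
qed

end

section \<open>Non-integrable mixing processes exceed their partial sums\<close>

text \<open>The positive lower bound makes the partial sums grow at least linearly, so that a single
  term is absorbed by later sums, and keeps the truncated means positive. The instance of interest
  is ln (d + 2), because ln d vanishes at d = 1.\<close>

locale weighted_mixing_process = mixing_process +
  fixes g :: "nat \<Rightarrow> real" and c :: real
  assumes c_pos: "c > 0" and g_ge: "\<And>d. g d \<ge> c"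
begin

definition X :: "nat \<Rightarrow> 'a \<Rightarrow> real" where "X k \<omega> = g (Y ((T ^^ k) \<omega>))"

definition S :: "nat \<Rightarrow> 'a \<Rightarrow> real" where "S n \<omega> = (\<Sum>k<n. X k \<omega>)"

lemma X_ge: "X k \<omega> \<ge> c" by (simp add: X_def g_ge)

lemma X_pos: "X k \<omega> > 0" using X_ge c_pos by (rule less_le_trans[rotated])

lemma S_nonneg: "S n \<omega> \<ge> 0" unfolding S_def using X_pos by (intro sum_nonneg less_imp_le)

lemma S_Suc: "S (Suc n) \<omega> = S n \<omega> + X n \<omega>" by (simp add: S_def)

lemma S_ge: "real n * c \<le> S n \<omega>"
  using sum_mono[of "{..<n}" "\<lambda>_. c" "\<lambda>k. X k \<omega>"] X_ge by (simp add: S_def)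

lemma X_shift: "X k ((T ^^ m) \<omega>) = X (k + m) \<omega>"
  by (simp add: X_def funpow_add)

lemma S_shift: "S (n + m) \<omega> = S m \<omega> + S n ((T ^^ m) \<omega>)"
  by (induction n) (auto simp: S_Suc X_shift, simp add: S_def)

lemma measurable_X_\<F>M: "k \<in> K \<Longrightarrow> X k \<in> borel_measurable (\<F>M K)"
  unfolding X_def by (rule measurable_compose[OF measurable_Y_\<F>M]) auto

lemma measurable_S_\<F>M: "{..<n} \<subseteq> K \<Longrightarrow> S n \<in> borel_measurable (\<F>M K)"
  unfolding S_def by (intro borel_measurable_sum measurable_X_\<F>M) auto

lemma measurable_X[measurable]: "X k \<in> borel_measurable M"
  unfolding X_def by measurable

lemma measurable_S[measurable]: "S k \<in> borel_measurable M"
  unfolding S_def by measurable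

section \<open>Truncated means and the growth of partial sums\<close>

definition trunc_mean :: "real \<Rightarrow> real" where
  "trunc_mean t = expectation (\<lambda>\<omega>. min (X 0 \<omega>) t)"

lemma integrable_trunc: "t \<ge> 0 \<Longrightarrow> integrable M (\<lambda>\<omega>. min (X k \<omega>) t)"
proof -
  assume "t \<ge> 0"
  then have "norm (min (X k \<omega>) t) \<le> t" for \<omega> using X_pos[of k \<omega>] by simp
  then show ?thesis by (intro integrable_const_bound[where B = t]) auto
qed

lemma expectation_trunc: "expectation (\<lambda>\<omega>. min (X k \<omega>) t) = trunc_mean t"
  using expectation_funpow[of "\<lambda>\<omega>. min (X 0 \<omega>) t" k] by (simp add: X_shift trunc_mean_def)

lemma trunc_mean_pos: "t > 0 \<Longrightarrow> trunc_mean t > 0"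
proof -
  assume t: "t > 0"
  have "min c t \<le> trunc_mean t" unfolding trunc_mean_def
    using t X_ge[of 0] by (intro integral_ge_const integrable_trunc AE_I2) (auto simp: min_le_iff_disj)
  then show ?thesis using t c_pos by linarith
qed

lemma trunc_mean_mono: "0 \<le> s \<Longrightarrow> s \<le> t \<Longrightarrow> trunc_mean s \<le> trunc_mean t"
  unfolding trunc_mean_def by (intro integral_mono integrable_trunc) auto

text \<open>For fixed x > 0 the quotient (min x t)/t is nonincreasing in t; taking expectations
  preserves this.\<close>

lemma ratio_trunc_mean_mono:
  assumes "0 < s" "s \<le> t"
  shows "s / trunc_mean s \<le> t / trunc_mean t"
proof -
  have pw: "min x t * s \<le> min x s * t" if "x > 0" for x :: real
    using that assms by (auto simp: min_def mult.commute mult_right_mono mult_left_mono)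
  have "expectation (\<lambda>\<omega>. min (X 0 \<omega>) t * s) \<le> expectation (\<lambda>\<omega>. min (X 0 \<omega>) s * t)"
    using assms pw[OF X_pos] by (intro integral_mono integrable_mult_left integrable_trunc) auto
  then have "trunc_mean t * s \<le> trunc_mean s * t" by (simp add: trunc_mean_def)
  then show ?thesis
    using trunc_mean_pos[of s] trunc_mean_pos[of t] assms by (simp add: field_simps)
qed

text \<open>If the sum reaches t, so does the sum of the terms truncated at t: either one term alone
  reaches t, or truncation changes nothing. The truncated sum has a finite mean, at most t/2 here,
  so Markov's inequality applies even when \<open>X 0\<close> is not integrable.\<close>

lemma prob_S_less:
  assumes t: "t > 0" and n: "real n * trunc_mean t \<le> t / 2"
  shows "1 / 2 \<le> prob {\<omega> \<in> space M. S n \<omega> < t}"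
proof -
  define u where "u \<omega> = (\<Sum>k<n. min (X k \<omega>) t)" for \<omega>
  have ui: "integrable M u" unfolding u_def using t by (intro Bochner_Integration.integrable_sum integrable_trunc) auto
  have Eu: "expectation u = real n * trunc_mean t"
    unfolding u_def using t
    by (subst Bochner_Integration.integral_sum) (auto intro: integrable_trunc simp: expectation_trunc)
  have u0: "0 \<le> u \<omega>" for \<omega> unfolding u_def using t X_pos by (intro sum_nonneg) (simp add: less_imp_le)
  have "u \<omega> \<ge> t" if "\<not> S n \<omega> < t" for \<omega>
  proof (cases "\<exists>k<n. X k \<omega> \<ge> t")
    case True
    then obtain k where k: "k < n" "X k \<omega> \<ge> t" by blast
    have "min (X k \<omega>) t \<le> u \<omega>" unfolding u_def
      using k t X_pos by (intro member_le_sum) (auto simp: less_imp_le)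
    then show ?thesis using k by simp
  next
    case False
    then have "u \<omega> = S n \<omega>" unfolding u_def S_def by (intro sum.cong) auto
    then show ?thesis using that by simp
  qed
  then have "prob {\<omega> \<in> space M. \<not> S n \<omega> < t} \<le> prob {\<omega> \<in> space M. t \<le> u \<omega>}"
    using ui by (intro finite_measure_mono) auto
  also have "\<dots> \<le> expectation u / t"
    using ui t u0 by (intro integral_Markov_inequality_measure[where A = "{}"]) auto
  also have "\<dots> \<le> 1 / 2" using n t by (simp add: Eu field_simps)
  finally show ?thesis using prob_neg[of "\<lambda>\<omega>. S n \<omega> < t"] by simp
qed

lemma measurable_of_Y[measurable]: "(\<lambda>\<omega>. f (Y \<omega>)) \<in> borel_measurable M"
  by (rule measurable_compose[OF Y]) simp

lemma X_0: "X 0 \<omega> = g (Y \<omega>)" by (simp add: X_def)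

lemma nn_integral_of_Y:
  fixes \<phi> :: "nat \<Rightarrow> ennreal"
  shows "(\<integral>\<^sup>+ \<omega>. \<phi> (Y \<omega>) \<partial>M) = (\<Sum>d. \<phi> d * emeasure M {\<omega> \<in> space M. Y \<omega> = d})"
proof -
  have "(\<integral>\<^sup>+ \<omega>. \<phi> (Y \<omega>) \<partial>M) = (\<integral>\<^sup>+ \<omega>. (\<Sum>d. \<phi> d * indicator {\<omega> \<in> space M. Y \<omega> = d} \<omega>) \<partial>M)"
  proof (rule nn_integral_cong)
    fix \<omega> assume "\<omega> \<in> space M"
    then have "(\<Sum>d. \<phi> d * indicator {\<omega> \<in> space M. Y \<omega> = d} \<omega>) = (\<Sum>d\<in>{Y \<omega>}. \<phi> d * indicator {\<omega> \<in> space M. Y \<omega> = d} \<omega>)"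
      by (intro suminf_finite) auto
    then show "\<phi> (Y \<omega>) = (\<Sum>d. \<phi> d * indicator {\<omega> \<in> space M. Y \<omega> = d} \<omega>)"
      using \<open>\<omega> \<in> space M\<close> by simp
  qed
  also have "\<dots> = (\<Sum>d. \<phi> d * emeasure M {\<omega> \<in> space M. Y \<omega> = d})"
    by (subst nn_integral_suminf) (auto simp: nn_integral_cmult_indicator)
  finally show ?thesis .
qed

text \<open>If \<open>h(X)\<close> were integrable for \<open>h(t) = t / trunc_mean t\<close>, then
  \<open>min X t \<le> N + trunc_mean t * h(X) 1{X > N}\<close> (monotonicity of \<open>trunc_mean\<close> and \<open>h\<close>) with
  \<open>E[h(X) 1{X > N}] \<le> 1/2\<close> would keep the truncated means bounded.\<close>

lemma nn_integral_ratio_trunc_mean: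
  assumes inf: "(\<integral>\<^sup>+ \<omega>. ennreal (X 0 \<omega>) \<partial>M) = \<infinity>"
  shows "(\<integral>\<^sup>+ \<omega>. ennreal (X 0 \<omega> / trunc_mean (X 0 \<omega>)) \<partial>M) = \<infinity>"
proof (rule ccontr)
  assume fin: "\<not> ?thesis"
  define H where "H \<omega> = X 0 \<omega> / trunc_mean (X 0 \<omega>)" for \<omega>
  have H0: "H \<omega> \<ge> 0" for \<omega>
    unfolding H_def using trunc_mean_pos[OF X_pos] X_pos by (simp add: less_imp_le)
  have [measurable]: "H \<in> borel_measurable M"
    unfolding H_def X_0 by (rule measurable_of_Y[where f = "\<lambda>d. g d / trunc_mean (g d)"])
  have Hi: "integrable M H"
    using fin H0 by (intro integrableI_nonneg) (auto simp: H_def less_top)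
  have "(\<lambda>i. expectation (\<lambda>\<omega>. if X 0 \<omega> > real i then H \<omega> else 0)) \<longlonglongrightarrow> expectation (\<lambda>\<omega>. 0)"
  proof (rule integral_dominated_convergence[where w = H])
    show "AE \<omega> in M. (\<lambda>i. if X 0 \<omega> > real i then H \<omega> else 0) \<longlonglongrightarrow> 0"
    proof (rule AE_I2, rule tendsto_eventually)
      fix \<omega>
      obtain N where "X 0 \<omega> \<le> real N" using real_arch_simple by blast
      then show "\<forall>\<^sub>F i in sequentially. (if X 0 \<omega> > real i then H \<omega> else 0) = 0"
        by (intro eventually_sequentiallyI[of N]) auto
    qed
  qed (use H0 Hi in auto)
  then have "\<forall>\<^sub>F i in sequentially. expectation (\<lambda>\<omega>. if X 0 \<omega> > real i then H \<omega> else 0) < 1/2"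
    by (intro order_tendstoD) auto
  then obtain N where N: "expectation (\<lambda>\<omega>. if X 0 \<omega> > real N then H \<omega> else 0) < 1/2"
    by (auto simp: eventually_sequentially)
  have bound: "trunc_mean t \<le> 2 * real N" if t: "t > 0" for t
  proof -
    have pw: "min (X 0 \<omega>) t \<le> real N + trunc_mean t * (if X 0 \<omega> > real N then H \<omega> else 0)" for \<omega>
    proof (cases "X 0 \<omega> > real N")
      case True
      have "min (X 0 \<omega>) t \<le> trunc_mean t * H \<omega>"
      proof (cases "X 0 \<omega> \<le> t")
        case True
        have "X 0 \<omega> = trunc_mean (X 0 \<omega>) * H \<omega>"
          using trunc_mean_pos[OF X_pos[of 0 \<omega>]] by (simp add: H_def)
        also have "\<dots> \<le> trunc_mean t * H \<omega>"
          using True X_pos[of 0 \<omega>] H0 by (intro mult_right_mono trunc_mean_mono) auto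
        finally show ?thesis by simp
      next
        case False
        have "t = trunc_mean t * (t / trunc_mean t)"
          using trunc_mean_pos[OF t] by simp
        also have "\<dots> \<le> trunc_mean t * H \<omega>"
          unfolding H_def using False t trunc_mean_pos[OF t]
          by (intro mult_left_mono ratio_trunc_mean_mono) auto
        finally show ?thesis by simp
      qed
      then show ?thesis using True by simp
    qed auto
    have "integrable M (\<lambda>\<omega>. if X 0 \<omega> > real N then H \<omega> else 0)"
      by (rule Bochner_Integration.integrable_bound[OF Hi]) (use H0 in auto)
    then have int: "integrable M (\<lambda>\<omega>. trunc_mean t * (if X 0 \<omega> > real N then H \<omega> else 0))" by simp
    have "trunc_mean t \<le> expectation (\<lambda>\<omega>. real N + trunc_mean t * (if X 0 \<omega> > real N then H \<omega> else 0))"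
      unfolding trunc_mean_def[of t] using t int[unfolded trunc_mean_def[of t]] pw[unfolded trunc_mean_def[of t]]
      by (intro integral_mono integrable_trunc Bochner_Integration.integrable_add) auto
    also have "\<dots> = real N + trunc_mean t * expectation (\<lambda>\<omega>. if X 0 \<omega> > real N then H \<omega> else 0)"
      by (subst Bochner_Integration.integral_add) (use int in \<open>simp_all add: prob_space\<close>)
    also have "\<dots> \<le> real N + trunc_mean t * (1/2)"
      using N trunc_mean_pos[OF t] by (intro add_left_mono mult_left_mono) auto
    finally show ?thesis by simp
  qed
  have sup: "ennreal x = (SUP n. ennreal (min x (real n)))" for x
  proof (rule antisym)
    obtain n where "x \<le> real n" using real_arch_simple by blast
    then show "ennreal x \<le> (SUP n. ennreal (min x (real n)))" by (intro SUP_upper2[of n]) auto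
  qed (auto intro!: SUP_least ennreal_leI)
  have "(\<integral>\<^sup>+ \<omega>. ennreal (X 0 \<omega>) \<partial>M) = (SUP n. \<integral>\<^sup>+ \<omega>. ennreal (min (X 0 \<omega>) (real n)) \<partial>M)"
    by (subst sup, rule nn_integral_monotone_convergence_SUP)
       (auto simp: incseq_def le_fun_def intro!: ennreal_leI)
  also have "\<dots> = (SUP n. ennreal (trunc_mean (real n)))"
    unfolding trunc_mean_def using X_pos
    by (intro SUP_cong refl nn_integral_eq_integral integrable_trunc) (auto simp: less_imp_le)
  also have "\<dots> \<le> ennreal (2 * real N)"
  proof (intro SUP_least ennreal_leI)
    fix n
    have "trunc_mean (real n) \<le> trunc_mean (real (Suc n))" by (intro trunc_mean_mono) auto
    also have "\<dots> \<le> 2 * real N" by (rule bound) simp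
    finally show "trunc_mean (real n) \<le> 2 * real N" .
  qed
  finally show False using inf by (simp add: top_unique)
qed

text \<open>The indices n <= y = t/(2 m(t)), where m is \<open>trunc_mean\<close>, number at least
  y, and each contributes at least 1/2. This gives y/2 = t/(4 m(t)).\<close>

lemma suminf_prob_S_less:
  assumes t: "t > 0"
  shows "ennreal (t / trunc_mean t / 4) \<le> (\<Sum>n. ennreal (prob {\<omega> \<in> space M. S n \<omega> < t}))"
proof -
  define y where "y = t / trunc_mean t / 2"
  define N where "N = nat \<lfloor>y\<rfloor>"
  have y: "y \<ge> 0" using t trunc_mean_pos[OF t] by (simp add: y_def)
  have N: "real N \<le> y" "y \<le> real (Suc N)" using y unfolding N_def by linarith+
  have "t / trunc_mean t / 4 = y / 2" by (simp add: y_def)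
  also have "\<dots> \<le> (\<Sum>n<Suc N. 1 / 2 :: real)" using N by simp
  also have "\<dots> \<le> (\<Sum>n<Suc N. prob {\<omega> \<in> space M. S n \<omega> < t})"
  proof (intro sum_mono prob_S_less t)
    fix n assume "n \<in> {..<Suc N}"
    then have "real n \<le> y" using N(1) by (auto simp: less_Suc_eq_le intro: order_trans[OF of_nat_mono])
    then show "real n * trunc_mean t \<le> t / 2" using trunc_mean_pos[OF t] by (simp add: y_def field_simps)
  qed
  finally have "ennreal (t / trunc_mean t / 4) \<le> ennreal (\<Sum>n<Suc N. prob {\<omega> \<in> space M. S n \<omega> < t})"
    by (rule ennreal_leI)
  also have "\<dots> = (\<Sum>n<Suc N. ennreal (prob {\<omega> \<in> space M. S n \<omega> < t}))"
    by (rule sum_ennreal[symmetric]) simp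
  also have "\<dots> \<le> (\<Sum>n. ennreal (prob {\<omega> \<in> space M. S n \<omega> < t}))"
    by (intro sum_le_suminf) auto
  finally show ?thesis .
qed

text \<open>\<open>S n\<close> is placed in \<open>\<F> {0..n + 1}\<close>, since the mixing
  condition demands an index of at least 1 for the past also when n = 0. A gap N after n + 1 then
  leads to the index n + 1 + N.\<close>

definition exceed :: "nat \<Rightarrow> real \<Rightarrow> nat \<Rightarrow> 'a set" where
  "exceed N \<kappa> n = {\<omega> \<in> space M. \<kappa> * S n \<omega> < X (n + 1 + N) \<omega>}"

lemma exceed_\<F>: "{0..n + 1 + N} \<subseteq> K \<Longrightarrow> exceed N \<kappa> n \<in> \<F> K"
proof -
  assume K: "{0..n + 1 + N} \<subseteq> K"
  have [measurable]: "S n \<in> borel_measurable (\<F>M K)" "X (n + 1 + N) \<in> borel_measurable (\<F>M K)"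
    using K by (auto intro!: measurable_S_\<F>M measurable_X_\<F>M)
  have "{\<omega> \<in> space (\<F>M K). \<kappa> * S n \<omega> < X (n + 1 + N) \<omega>} \<in> sets (\<F>M K)" by measurable
  then show ?thesis by (simp add: exceed_def)
qed

lemma exceed_events[measurable]: "exceed N \<kappa> n \<in> events"
  unfolding exceed_def by measurable

text \<open>Discarding the terms of \<open>S n\<close> with index below b = m + N + 2 only enlarges
  the later event and turns it into a preimage under \<open>T ^^ b\<close>. The earlier event uses
  coordinates up to b - 1, so gap 1 suffices, and stationarity moves the preimage back to index n -
  b.\<close>

lemma prob_exceed_inter:
  assumes "m + (N + 2) \<le> n" "\<kappa> \<ge> 0"
  shows "prob (exceed N \<kappa> m \<inter> exceed N \<kappa> n)
    \<le> (1 + \<theta> 1) * prob (exceed N \<kappa> m) * prob (exceed N \<kappa> (n - m - (N + 2)))"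
proof -
  define b where "b = m + (N + 2)"
  define A where "A = exceed N \<kappa> m"
  define B where "B = (T ^^ b) -` exceed N \<kappa> (n - b) \<inter> space M"
  have A: "A \<in> \<F> {0..m + 1 + N}" unfolding A_def by (rule exceed_\<F>) simp
  have B: "B \<in> \<F> {(m + 1 + N) + 1..}"
    using vimage_funpow_\<F>[OF exceed_\<F>[of "n - b" N UNIV \<kappa>], of b] by (simp add: B_def b_def ac_simps)
  have "exceed N \<kappa> n \<subseteq> B"
  proof
    fix \<omega> assume "\<omega> \<in> exceed N \<kappa> n"
    then have \<omega>: "\<omega> \<in> space M" "\<kappa> * S n \<omega> < X (n + 1 + N) \<omega>" by (auto simp: exceed_def)
    have "S n \<omega> = S b \<omega> + S (n - b) ((T ^^ b) \<omega>)" using S_shift[of "n - b" b \<omega>] assms(1) unfolding b_def by (simp only: le_add_diff_inverse2)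
    then have "\<kappa> * S (n - b) ((T ^^ b) \<omega>) \<le> \<kappa> * S n \<omega>"
      using S_nonneg[of b \<omega>] assms by (intro mult_left_mono) auto
    moreover have "X (n - b + 1 + N) ((T ^^ b) \<omega>) = X (n + 1 + N) \<omega>"
      unfolding X_shift b_def using assms(1) by (intro arg_cong2[where f = X] refl) arith
    ultimately show "\<omega> \<in> B" using \<omega> funpow_T_space[OF \<omega>(1)] unfolding B_def exceed_def by auto
  qed
  then have "prob (A \<inter> exceed N \<kappa> n) \<le> prob (A \<inter> B)"
    using A B \<F>_subset by (intro finite_measure_mono) auto
  also have "\<dots> \<le> prob A * prob B + \<theta> 1 * prob A * prob B"
    using mixing[OF _ _ A B] by simp
  also have "prob B = prob (exceed N \<kappa> (n - b))"
    unfolding B_def by (rule prob_funpow_vimage) simp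
  finally show ?thesis by (simp add: A_def b_def algebra_simps)
qed

text \<open>The mixing lower bound across the gap decouples \<open>X (n + 1 + N)\<close> from \<open>S n\<close>.\<close>

lemma not_summable_prob_exceed:
  assumes N: "N \<ge> 1" "\<theta> N \<le> 1/2" and \<kappa>: "\<kappa> \<ge> 1"
    and inf: "(\<integral>\<^sup>+ \<omega>. ennreal (X 0 \<omega>) \<partial>M) = \<infinity>"
  shows "\<not> summable (\<lambda>n. prob (exceed N \<kappa> n))"
proof
  assume "summable (\<lambda>n. prob (exceed N \<kappa> n))"
  then have fin: "(\<Sum>n. ennreal (prob (exceed N \<kappa> n))) \<noteq> top" by (rule ennreal_suminf_neq_top) simp
  define \<psi> where "\<psi> n d = ennreal (prob {\<omega> \<in> space M. S n \<omega> < g d / \<kappa>})" for n d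
  have lower: "(\<integral>\<^sup>+ \<omega>. ennreal (1/2) * \<psi> n (Y \<omega>) \<partial>M) \<le> ennreal (prob (exceed N \<kappa> n))" for n
  proof -
    \<comment> \<open>The random threshold is split by the value d of the digit. For fixed d the
      condition on the past is a level set of \<open>S n\<close>, so mixing applies value by value
      and the disjoint pieces are summed.\<close>
    define A where "A d = {\<omega> \<in> space M. S n \<omega> < g d / \<kappa>}" for d
    define B where "B d = {\<omega> \<in> space M. Y ((T ^^ (n + 1 + N)) \<omega>) = d}" for d
    have A: "A d \<in> \<F> {0..n + 1}" for d
    proof -
      have [measurable]: "S n \<in> borel_measurable (\<F>M {0..n+1})" by (rule measurable_S_\<F>M) auto
      have "{\<omega> \<in> space (\<F>M {0..n+1}). S n \<omega> < g d / \<kappa>} \<in> sets (\<F>M {0..n+1})" by measurable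
      then show ?thesis by (simp add: A_def)
    qed
    have B: "B d \<in> \<F> {n + 1 + N..}" for d
    proof -
      have [measurable]: "(\<lambda>\<omega>. Y ((T ^^ (n + 1 + N)) \<omega>)) \<in> measurable (\<F>M {n + 1 + N..}) (count_space UNIV)"
        by (rule measurable_Y_\<F>M) simp
      have "{\<omega> \<in> space (\<F>M {n + 1 + N..}). Y ((T ^^ (n + 1 + N)) \<omega>) = d} \<in> sets (\<F>M {n + 1 + N..})" by measurable
      then show ?thesis by (simp add: B_def)
    qed
    have pB: "prob (B d) = prob {\<omega> \<in> space M. Y \<omega> = d}" for d
      unfolding B_def by (rule prob_funpow_Collect) measurable
    have AB: "prob (A d) * prob (B d) / 2 \<le> prob (A d \<inter> B d)" for d
    proof -
      have "\<theta> N * (prob (A d) * prob (B d)) \<le> 1/2 * (prob (A d) * prob (B d))"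
        using N by (intro mult_right_mono) auto
      then show ?thesis using mixing[OF _ N(1) A[of d] B[of d]] by (simp add: mult.assoc abs_le_iff)
    qed
    have ev: "A d \<inter> B d \<in> events" for d using A[of d] B[of d] \<F>_subset by auto
    have "(\<integral>\<^sup>+ \<omega>. ennreal (1/2) * \<psi> n (Y \<omega>) \<partial>M) = (\<Sum>d. ennreal (1/2) * \<psi> n d * emeasure M {\<omega> \<in> space M. Y \<omega> = d})"
      by (rule nn_integral_of_Y)
    also have "\<dots> \<le> (\<Sum>d. emeasure M (A d \<inter> B d))"
    proof (rule suminf_le)
      fix d
      have "ennreal (1/2) * \<psi> n d * emeasure M {\<omega> \<in> space M. Y \<omega> = d} = ennreal (prob (A d) * prob (B d) / 2)"
        unfolding \<psi>_def pB A_def by (simp only: emeasure_eq_measure) (simp add: ennreal_mult[symmetric] del: ennreal_half)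
      also have "\<dots> \<le> ennreal (prob (A d \<inter> B d))" by (rule ennreal_leI[OF AB])
      finally show "ennreal (1/2) * \<psi> n d * emeasure M {\<omega> \<in> space M. Y \<omega> = d} \<le> emeasure M (A d \<inter> B d)"
        by (simp add: emeasure_eq_measure)
    qed auto
    also have "\<dots> = emeasure M (\<Union>d. A d \<inter> B d)"
      using ev by (intro suminf_emeasure) (auto simp: disjoint_family_on_def B_def)
    also have "\<dots> \<le> emeasure M (exceed N \<kappa> n)"
    proof (intro emeasure_mono)
      show "(\<Union>d. A d \<inter> B d) \<subseteq> exceed N \<kappa> n"
        using \<kappa> by (auto simp: A_def B_def exceed_def X_def field_simps)
    qed simp
    finally show ?thesis by (simp add: emeasure_eq_measure)
  qed
  \<comment> \<open>The factor 8 \<kappa> collects 1/2 from mixing, 1/4 from counting indices, and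
    1/\<kappa> from using the level t/\<kappa>, whose truncated mean is at most that of t.\<close>
  have "\<infinity> = ennreal (1 / (8 * \<kappa>)) * (\<integral>\<^sup>+ \<omega>. ennreal (X 0 \<omega> / trunc_mean (X 0 \<omega>)) \<partial>M)"
    using nn_integral_ratio_trunc_mean[OF inf] \<kappa> by (simp add: ennreal_mult_top)
  also have "\<dots> = (\<integral>\<^sup>+ \<omega>. ennreal (1 / (8 * \<kappa>)) * ennreal (X 0 \<omega> / trunc_mean (X 0 \<omega>)) \<partial>M)"
    unfolding X_0 by (rule nn_integral_cmult[symmetric]) (rule measurable_of_Y[where f = "\<lambda>d. ennreal (g d / trunc_mean (g d))"])
  also have "\<dots> \<le> (\<integral>\<^sup>+ \<omega>. (\<Sum>n. ennreal (1/2) * \<psi> n (Y \<omega>)) \<partial>M)"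
  proof (rule nn_integral_mono)
    fix \<omega>
    define t where "t = g (Y \<omega>)"
    have t: "t > 0" "t / \<kappa> > 0" "t / \<kappa> \<le> t"
      using g_ge[of "Y \<omega>"] c_pos \<kappa> by (auto simp: t_def field_simps)
    have m: "trunc_mean (t / \<kappa>) > 0" "trunc_mean (t / \<kappa>) \<le> trunc_mean t"
      using t by (auto intro: trunc_mean_pos trunc_mean_mono)
    have "1 / (8 * \<kappa>) * (t / trunc_mean t) = 1/8 * (t / \<kappa> / trunc_mean t)" by simp
    also have "\<dots> \<le> 1/8 * (t / \<kappa> / trunc_mean (t / \<kappa>))"
      using t m by (intro mult_left_mono divide_left_mono mult_pos_pos) auto
    finally have "ennreal (1 / (8 * \<kappa>)) * ennreal (t / trunc_mean t) \<le> ennreal (1/2 * (t / \<kappa> / trunc_mean (t / \<kappa>) / 4))"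
      using \<kappa> t m by (subst ennreal_mult[symmetric]) (auto intro!: ennreal_leI)
    also have "\<dots> = ennreal (1/2) * ennreal (t / \<kappa> / trunc_mean (t / \<kappa>) / 4)"
      by (rule ennreal_mult) (use t(2) m(1) in \<open>auto intro!: divide_nonneg_pos simp del: divide_divide_eq_left\<close>)
    also have "\<dots> \<le> ennreal (1/2) * (\<Sum>n. \<psi> n (Y \<omega>))"
      using suminf_prob_S_less[OF t(2)] by (intro mult_left_mono) (auto simp: \<psi>_def t_def)
    finally show "ennreal (1 / (8 * \<kappa>)) * ennreal (X 0 \<omega> / trunc_mean (X 0 \<omega>)) \<le> (\<Sum>n. ennreal (1/2) * \<psi> n (Y \<omega>))"
      by (simp add: X_0 t_def)
  qed
  also have "\<dots> = (\<Sum>n. \<integral>\<^sup>+ \<omega>. ennreal (1/2) * \<psi> n (Y \<omega>) \<partial>M)"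
    by (rule nn_integral_suminf) (rule measurable_of_Y)
  also have "\<dots> \<le> (\<Sum>n. ennreal (prob (exceed N \<kappa> n)))"
    by (intro suminf_le lower) auto
  finally show False using fin by (simp add: top_unique)
qed

theorem AE_exceeds_partial_sums:
  assumes inf: "(\<integral>\<^sup>+ \<omega>. ennreal (X 0 \<omega>) \<partial>M) = \<infinity>"
  shows "AE \<omega> in M. \<forall>K::nat. \<exists>\<^sub>F n in sequentially. real K * S n \<omega> < X n \<omega>"
proof -
  have "\<forall>\<^sub>F n in sequentially. \<theta> n < 1/2 \<and> n \<ge> 1"
    using theta_tendsto by (intro eventually_conj order_tendstoD eventually_ge_at_top) auto
  then obtain N where N: "N \<ge> 1" "\<theta> N \<le> 1/2" by (auto simp: eventually_sequentially intro: less_imp_le)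
  define \<delta> where "\<delta> = 1 / (2 + 4 * (1 + \<theta> 1))"
  have \<delta>: "\<delta> > 0" using theta_nonneg[of 1] by (simp add: \<delta>_def)
  \<comment> \<open>Threshold and starting index grow together with \<kappa>. The decreasing
    intersection then says at once that exceedances recur beyond any index and that their factor is
    arbitrary, while the bound \<delta> survives the limit.\<close>
  define U where "U \<kappa> = (\<Union>n\<in>{Suc \<kappa>..}. exceed N (real (Suc \<kappa>)) n)" for \<kappa> :: nat
  have U: "\<delta> \<le> prob (U \<kappa>)" for \<kappa>
    unfolding \<delta>_def U_def
    by (rule kochen_stone_renewal[where b = "N + 2"])
       (use theta_nonneg[of 1] prob_exceed_inter not_summable_prob_exceed[OF N _ inf] in auto)
  have UF: "U \<kappa> \<in> \<F> UNIV" for \<kappa>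
  proof -
    have "U \<kappa> \<in> sets (\<F>M UNIV)" unfolding U_def by (intro sets.countable_UN) (auto intro: exceed_\<F>)
    then show ?thesis by simp
  qed
  have dec: "decseq U"
  proof (rule decseq_SucI)
    fix \<kappa>
    have "exceed N (real (Suc (Suc \<kappa>))) n \<subseteq> exceed N (real (Suc \<kappa>)) n" for n
    proof
      fix \<omega> assume "\<omega> \<in> exceed N (real (Suc (Suc \<kappa>))) n"
      then show "\<omega> \<in> exceed N (real (Suc \<kappa>)) n"
        using S_nonneg[of n \<omega>] by (auto simp: exceed_def algebra_simps)
    qed
    then show "U (Suc \<kappa>) \<subseteq> U \<kappa>" unfolding U_def by (intro UN_mono) auto
  qed
  define E where "E = (\<Inter>\<kappa>. U \<kappa>)"
  have EF: "E \<in> \<F> UNIV"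
  proof -
    have "E \<in> sets (\<F>M UNIV)" unfolding E_def by (intro sets.countable_INT) (use UF in auto)
    then show ?thesis by simp
  qed
  then have Eev: "E \<in> events" using \<F>_subset by auto
  have "(\<lambda>\<kappa>. prob (U \<kappa>)) \<longlonglongrightarrow> prob E"
    unfolding E_def using UF \<F>_subset dec by (intro finite_Lim_measure_decseq) auto
  then have "\<delta> \<le> prob E" by (rule LIMSEQ_le_const) (use U in auto)
  then have Epos: "prob E \<noteq> 0" using \<delta> by linarith
  have E_iff: "\<omega> \<in> E \<longleftrightarrow> (\<forall>\<kappa>::nat. \<exists>n\<ge>Suc \<kappa>. real (Suc \<kappa>) * S n \<omega> < X (n + 1 + N) \<omega>)" if "\<omega> \<in> space M" for \<omega>
    using that by (auto simp: E_def U_def exceed_def)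
  have inv: "T \<omega> \<in> E \<longleftrightarrow> \<omega> \<in> E" if \<omega>: "\<omega> \<in> space M" for \<omega>
  proof -
    have T\<omega>: "T \<omega> \<in> space M" using funpow_T_space[OF \<omega>, of 1] by simp
    have sh: "S (Suc n) \<omega> = X 0 \<omega> + S n (T \<omega>)" "X k (T \<omega>) = X (Suc k) \<omega>" for n k
      using S_shift[of n 1 \<omega>] X_shift[of k 1 \<omega>] by (auto simp: S_def)
    show ?thesis
    proof
      assume E: "\<omega> \<in> E"
      show "T \<omega> \<in> E"
        unfolding E_iff[OF T\<omega>]
      proof
        fix \<kappa> :: nat
        obtain n where n: "n \<ge> Suc (Suc \<kappa>)" "real (Suc (Suc \<kappa>)) * S n \<omega> < X (n + 1 + N) \<omega>"
          using E unfolding E_iff[OF \<omega>] by blast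
        obtain n' where n': "n = Suc n'" using n by (cases n) auto
        have "real (Suc \<kappa>) * S n' (T \<omega>) \<le> real (Suc (Suc \<kappa>)) * S n \<omega>"
          unfolding n' using X_pos[of 0 \<omega>] S_nonneg[of n' "T \<omega>"] by (intro mult_mono) (auto simp: sh)
        then have "real (Suc \<kappa>) * S n' (T \<omega>) < X (n' + 1 + N) (T \<omega>)"
          using n by (simp add: sh n')
        then show "\<exists>n\<ge>Suc \<kappa>. real (Suc \<kappa>) * S n (T \<omega>) < X (n + 1 + N) (T \<omega>)"
          using n n' by (intro exI[of _ n']) auto
      qed
    next
      assume E: "T \<omega> \<in> E"
      show "\<omega> \<in> E"
        unfolding E_iff[OF \<omega>]
      proof
        fix \<kappa> :: nat
        \<comment> \<open>Prepending \<open>X 0\<close> at most doubles the partial sum once n >= X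
          0 / c. Hence the doubled factor and the additional summand in the starting index.\<close>
        define \<kappa>' where "\<kappa>' = 2 * Suc \<kappa> + nat \<lceil>X 0 \<omega> / c\<rceil>"
        obtain n where n: "n \<ge> Suc \<kappa>'" "real (Suc \<kappa>') * S n (T \<omega>) < X (n + 1 + N) (T \<omega>)"
          using E unfolding E_iff[OF T\<omega>] by blast
        have "X 0 \<omega> / c \<le> real n" using n by (simp add: \<kappa>'_def) linarith
        then have "X 0 \<omega> \<le> S n (T \<omega>)" using c_pos S_ge[of n "T \<omega>"] by (simp add: field_simps)
        then have "S (Suc n) \<omega> \<le> 2 * S n (T \<omega>)" by (simp add: sh)
        then have "real (Suc \<kappa>) * S (Suc n) \<omega> \<le> real (Suc \<kappa>) * (2 * S n (T \<omega>))"
          by (intro mult_left_mono) auto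
        also have "\<dots> = real (2 * Suc \<kappa>) * S n (T \<omega>)" by simp
        also have "\<dots> \<le> real (Suc \<kappa>') * S n (T \<omega>)"
          using S_nonneg by (intro mult_right_mono of_nat_mono) (auto simp: \<kappa>'_def)
        also have "\<dots> < X (Suc n + 1 + N) \<omega>" using n by (simp add: sh)
        finally show "\<exists>n\<ge>Suc \<kappa>. real (Suc \<kappa>) * S n \<omega> < X (n + 1 + N) \<omega>"
          using n by (intro exI[of _ "Suc n"]) (auto simp: \<kappa>'_def)
      qed
    qed
  qed
  have "prob E = 1" using invariant_event_0_1[OF EF inv] Epos by auto
  then have "AE \<omega> in M. \<omega> \<in> E" using Eev by (simp add: prob_eq_1)
  then show ?thesis
  proof (rule AE_mp, intro AE_I2 impI allI)
    fix \<omega> and K :: nat assume \<omega>: "\<omega> \<in> space M" "\<omega> \<in> E"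
    show "\<exists>\<^sub>F n in sequentially. real K * S n \<omega> < X n \<omega>"
      unfolding frequently_sequentially
    proof
      fix n0
      \<comment> \<open>Large enough both to start beyond \<open>n0\<close> and to beat the factor
        (1 + K)^(N + 2) by which the partial sums can grow across the gap if no exceedance occurs
        there.\<close>
      define \<kappa> where "\<kappa> = n0 + (1 + K) ^ (N + 2)"
      obtain n where n: "n \<ge> Suc \<kappa>" "real (Suc \<kappa>) * S n \<omega> < X (n + 1 + N) \<omega>"
        using \<omega> E_iff by blast
      show "\<exists>n\<ge>n0. real K * S n \<omega> < X n \<omega>"
      proof (rule ccontr)
        assume "\<not> ?thesis"
        then have le: "X j \<omega> \<le> real K * S j \<omega>" if "j \<ge> n0" for j using that by (meson not_less)
        have grow: "S (n + i) \<omega> \<le> real ((1 + K) ^ i) * S n \<omega>" for i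
        proof (induction i)
          case (Suc i)
          have "S (n + Suc i) \<omega> \<le> (1 + real K) * S (n + i) \<omega>"
            using le[of "n + i"] n by (simp add: S_Suc \<kappa>_def algebra_simps)
          also have "\<dots> \<le> (1 + real K) * (real ((1 + K) ^ i) * S n \<omega>)"
            using Suc by (intro mult_left_mono) auto
          finally show ?case by (simp add: algebra_simps)
        qed simp
        have "X (n + 1 + N) \<omega> \<le> S (n + (N + 2)) \<omega>"
          using S_Suc[of "n + 1 + N" \<omega>] S_nonneg[of "n + 1 + N" \<omega>] by simp
        also have "\<dots> \<le> real ((1 + K) ^ (N + 2)) * S n \<omega>" by (rule grow)
        also have "\<dots> \<le> real (Suc \<kappa>) * S n \<omega>"
          using S_nonneg[of n \<omega>] by (intro mult_right_mono of_nat_mono) (simp_all add: \<kappa>_def)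
        finally show False using n by simp
      qed
    qed
  qed
qed

end

section \<open>Generic digits under invariant measures\<close>

text \<open>The number of n with e n < f(Y) is at most f(Y)/e + 1. By stationarity the integral of
  this count is the sum of the probabilities in question, so Borel-Cantelli applies. The general
  setting serves both the log-digits of the Gauss map and the random heights of the later
  construction.\<close>

lemma (in stationary_process) AE_sublinear:
  fixes f :: "nat \<Rightarrow> real"
  assumes f: "\<And>d. f d \<ge> 0" and fin: "(\<integral>\<^sup>+ \<omega>. ennreal (f (Y \<omega>)) \<partial>M) < \<infinity>"
  shows "AE \<omega> in M. \<forall>e>0. \<forall>\<^sub>F n in sequentially. f (Y ((T ^^ n) \<omega>)) \<le> e * real n"
proof -
  have [measurable]: "(\<lambda>\<omega>. f (Y \<omega>)) \<in> borel_measurable M" by (rule measurable_compose[OF Y]) simp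
  have ev: "AE \<omega> in M. \<forall>\<^sub>F n in sequentially. f (Y ((T ^^ n) \<omega>)) \<le> e * real n" if e: "e > 0" for e
  proof -
    define B where "B n = {\<omega> \<in> space M. e * real n < f (Y ((T ^^ n) \<omega>))}" for n
    define A where "A n = {\<omega> \<in> space M. e * real n < f (Y \<omega>)}" for n
    have [measurable]: "B n \<in> events" "A n \<in> events" for n by (simp_all add: B_def A_def)
    have pB: "prob (B n) = prob (A n)" for n
      unfolding A_def B_def by (rule prob_funpow_Collect) measurable
    have pw: "(\<Sum>n. indicator (A n) \<omega> :: ennreal) \<le> ennreal (1 / e) * ennreal (f (Y \<omega>)) + 1" for \<omega>
    proof -
      define N where "N = nat \<lceil>f (Y \<omega>) / e\<rceil>"
      have y0: "f (Y \<omega>) / e \<ge> 0" using f[of "Y \<omega>"] e by simp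
      have "(\<Sum>n. indicator (A n) \<omega> :: ennreal) = (\<Sum>n<N. indicator (A n) \<omega>)"
      proof (rule suminf_finite)
        fix n assume "n \<notin> {..<N}"
        then have "f (Y \<omega>) / e \<le> real n" unfolding N_def by (simp add: not_less nat_le_iff ceiling_le_iff)
        then have "\<omega> \<notin> A n" using e by (simp add: A_def field_simps)
        then show "indicator (A n) \<omega> = (0 :: ennreal)" by simp
      qed simp
      also have "\<dots> \<le> (\<Sum>n<N. 1)" by (intro sum_mono) (simp add: indicator_def)
      also have "\<dots> = ennreal (real N)" by (simp add: ennreal_of_nat_eq_real_of_nat)
      also have "\<dots> \<le> ennreal (f (Y \<omega>) / e + 1)"
        unfolding N_def using y0 by (intro ennreal_leI) linarith
      also have "\<dots> = ennreal (1 / e) * ennreal (f (Y \<omega>)) + 1"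
        using f[of "Y \<omega>"] e by (simp add: ennreal_mult[symmetric] ennreal_plus)
      finally show ?thesis .
    qed
    have "(\<Sum>n. ennreal (prob (B n))) = (\<Sum>n. \<integral>\<^sup>+ \<omega>. indicator (A n) \<omega> \<partial>M)"
      by (simp add: pB emeasure_eq_measure)
    also have "\<dots> = (\<integral>\<^sup>+ \<omega>. (\<Sum>n. indicator (A n) \<omega>) \<partial>M)"
      by (rule nn_integral_suminf[symmetric]) simp
    also have "\<dots> \<le> (\<integral>\<^sup>+ \<omega>. ennreal (1 / e) * ennreal (f (Y \<omega>)) + 1 \<partial>M)"
      by (intro nn_integral_mono pw)
    also have "\<dots> = ennreal (1 / e) * (\<integral>\<^sup>+ \<omega>. ennreal (f (Y \<omega>)) \<partial>M) + 1"
      by (simp add: nn_integral_add nn_integral_cmult emeasure_space_1)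
    also have "\<dots> < \<infinity>" using fin by (simp add: ennreal_mult_less_top)
    finally have "summable (\<lambda>n. prob (B n))" by (intro summable_suminf_not_top) auto
    then have "AE \<omega> in M. \<forall>\<^sub>F n in sequentially. \<omega> \<in> space M - B n"
      by (intro borel_cantelli_AE1) (auto simp: emeasure_eq_measure)
    then show ?thesis
      by (rule AE_mp) (auto intro!: AE_I2 elim!: eventually_mono simp: B_def not_less)
  qed
  have "AE \<omega> in M. \<forall>k::nat. \<forall>\<^sub>F n in sequentially. f (Y ((T ^^ n) \<omega>)) \<le> 1 / real (Suc k) * real n"
    unfolding AE_all_countable by (intro allI ev) simp
  then show ?thesis
  proof (rule AE_mp, intro AE_I2 impI allI)
    fix \<omega> and e :: real
    assume \<omega>: "\<forall>k::nat. \<forall>\<^sub>F n in sequentially. f (Y ((T ^^ n) \<omega>)) \<le> 1 / real (Suc k) * real n" and "e > 0"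
    then obtain k where k: "1 / real (Suc k) < e" using nat_approx_posE by blast
    have "\<forall>\<^sub>F n in sequentially. f (Y ((T ^^ n) \<omega>)) \<le> 1 / real (Suc k) * real n" using \<omega> by blast
    then show "\<forall>\<^sub>F n in sequentially. f (Y ((T ^^ n) \<omega>)) \<le> e * real n"
    proof (rule eventually_mono)
      fix n assume "f (Y ((T ^^ n) \<omega>)) \<le> 1 / real (Suc k) * real n"
      also have "\<dots> \<le> e * real n" using k by (intro mult_right_mono) auto
      finally show "f (Y ((T ^^ n) \<omega>)) \<le> e * real n" .
    qed
  qed
qed

section \<open>Pointwise criteria for Diophantine and Liouville numbers\<close>

lemma ln_cf_denom_ge:
  assumes "x \<in> irrational_unit"
  shows "(real n - 1) * ln 2 \<le> 2 * ln (real (cf_denom (cf_digit x) n))"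
proof -
  let ?q = "cf_denom (cf_digit x) n"
  have q: "?q \<ge> 1" using cf_denom_pos[OF cf_digit_pos[OF assms]] .
  have "real (2 ^ n) \<le> real (2 * ?q\<^sup>2)"
    using cf_denom_exponential[of "cf_digit x" n, OF cf_digit_pos[OF assms]] by (simp only: of_nat_le_iff)
  then have "ln (2 ^ n :: real) \<le> ln (2 * (real ?q)\<^sup>2)" using q by (intro ln_mono) auto
  then show ?thesis using q by (simp add: ln_mult ln_realpow algebra_simps)
qed

lemma diophantine_if_digits_sublinear:
  assumes x: "x \<in> irrational_unit"
    and ev: "\<And>e. e > 0 \<Longrightarrow> \<forall>\<^sub>F n in sequentially. ln (real (cf_digit x n)) \<le> e * real n"
  shows "diophantine x"
proof -
  have "irrationality_exponent x \<le> ereal (2 + 0)"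
  proof (rule irrationality_exponent_le[OF x])
    fix t :: real assume t: "t > 0"
    \<comment> \<open>The factor comes from ln q_n >= (n - 1) (ln 2)/2, which is at least n (ln 2)/4
      from n = 2 on.\<close>
    have "\<forall>\<^sub>F n in sequentially. ln (real (cf_digit x n)) \<le> (t * ln 2 / 4) * real n"
      using t by (intro ev) simp
    then show "\<forall>\<^sub>F n in sequentially. ln (real (cf_digit x n)) \<le> t * ln (real (cf_denom (cf_digit x) n))"
      using eventually_ge_at_top[of 2]
    proof eventually_elim
      case (elim n)
      have "t * (ln 2 * (real n / 4)) \<le> t * (ln 2 * ((real n - 1) / 2))"
        using t elim(2) by (intro mult_left_mono) auto
      also have "\<dots> \<le> t * ln (real (cf_denom (cf_digit x) n))"
        using ln_cf_denom_ge[OF x, of n] t by (intro mult_left_mono) (auto simp: mult.commute)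
      finally show ?case using elim(1) by simp
    qed
  qed simp
  then show ?thesis
    using irrationality_exponent_ge_2[OF x] by (simp add: diophantine_def antisym)
qed

lemma liouville_if_digit_exceeds_sum:
  assumes x: "x \<in> irrational_unit"
    and io: "\<And>K::nat. \<exists>\<^sub>F n in sequentially.
      real K * (\<Sum>k<n. ln (real (cf_digit x k) + 2)) < ln (real (cf_digit x n) + 2)"
  shows "liouville x"
proof (rule liouville_if_digits_ge[OF x])
  fix K :: nat
  let ?S = "\<lambda>n. \<Sum>k<n. ln (real (cf_digit x k) + 2)"
  \<comment> \<open>The shift by 2 in the weights is undone by ln (a + 2) <= 3 ln a for a >= 2,
    whence the factor 3. The summand 1 keeps the coefficient at least 1, which together with n >= 1
    forces a_n >= 2 even for K = 0.\<close>
  have "\<exists>\<^sub>F n in sequentially. real (3 * K + 1) * ?S n < ln (real (cf_digit x n) + 2) \<and> n \<ge> 1"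
    using frequently_eventually_frequently[OF io eventually_ge_at_top] .
  then show "\<exists>\<^sub>F n in sequentially. real K * ln (real (cf_denom (cf_digit x) n)) \<le> ln (real (cf_digit x n))"
  proof (rule frequently_elim1, elim conjE)
    fix n assume n: "real (3 * K + 1) * ?S n < ln (real (cf_digit x n) + 2)" "n \<ge> 1"
    have S0: "0 \<le> ?S n" by (intro sum_nonneg) simp
    have "ln (real (cf_digit x 0) + 2) \<le> ?S n"
      using n(2) by (intro member_le_sum) auto
    moreover have "ln 3 \<le> ln (real (cf_digit x 0) + 2)"
      using cf_digit_pos[OF x, of 0] by (intro ln_mono) auto
    moreover have "?S n \<le> real (3 * K + 1) * ?S n" using S0 by (simp add: mult_le_cancel_right1)
    ultimately have "ln 3 < ln (real (cf_digit x n) + 2)" using n(1) by linarith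
    then have a2: "cf_digit x n \<ge> 2" by (subst (asm) ln_less_cancel_iff) auto
    define a where "a = real (cf_digit x n)"
    have a: "a \<ge> 2" using a2 by (simp add: a_def)
    have "a + 2 \<le> 2 * a" using a by simp
    also have "\<dots> \<le> a * a" using a by (intro mult_right_mono) auto
    also have "\<dots> \<le> a * a * a" using a by (simp add: mult_le_cancel_left1)
    finally have "a + 2 \<le> a ^ 3" by (simp add: power3_eq_cube)
    then have "ln (a + 2) \<le> ln (a ^ 3)" using a by (intro ln_mono) auto
    then have 1: "ln (a + 2) \<le> 3 * ln a" using a by (simp add: ln_realpow)
    have "ln (real (cf_denom (cf_digit x) n)) \<le> (\<Sum>k<n. ln (real (cf_digit x k) + 1))"
      by (rule ln_cf_denom_le_sum[OF cf_digit_pos[OF x]])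
    also have "\<dots> \<le> ?S n" by (intro sum_mono ln_mono) auto
    finally have "3 * (real K * ln (real (cf_denom (cf_digit x) n))) \<le> 3 * (real K * ?S n)"
      by (intro mult_left_mono) auto
    also have "\<dots> \<le> real (3 * K + 1) * ?S n" using S0 by (simp add: algebra_simps)
    finally show "real K * ln (real (cf_denom (cf_digit x) n)) \<le> ln (real (cf_digit x n))"
      using n(1) 1 by (simp add: a_def)
  qed
qed

lemma space_borel_probabilities: "M \<in> borel_probabilities S \<Longrightarrow> space M = S"
  unfolding borel_probabilities_def using sets_eq_imp_space_eq[of M "restrict_space borel S"]
  by (auto simp: space_restrict_space)

lemma measurable_borel_probabilities:
  assumes "M \<in> borel_probabilities S" "f \<in> measurable borel N"
  shows "f \<in> measurable M N"
  using measurable_restrict_space1[OF assms(2), of S] assms(1)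
  by (simp add: borel_probabilities_def cong: measurable_cong_sets)

lemma measurable_digit: "digit \<in> measurable borel (count_space UNIV)"
  unfolding digit_def[abs_def] by measurable

lemma stationary_process_gauss_map:
  assumes "\<mu> \<in> borel_probabilities irrational_unit" "invariant_measure gauss_map \<mu>"
  shows "stationary_process \<mu> gauss_map digit"
  using assms measurable_borel_probabilities[OF assms(1) measurable_digit]
  by (auto simp: stationary_process_def stationary_process_axioms_def borel_probabilities_def invariant_measure_def)

theorem AE_diophantine:
  assumes \<mu>: "\<mu> \<in> borel_probabilities irrational_unit" "invariant_measure gauss_map \<mu>"
    and fin: "(\<integral>\<^sup>+ x. ennreal (ln (real (digit x))) \<partial>\<mu>) < \<infinity>"
  shows "AE x in \<mu>. diophantine x"
proof -
  interpret stationary_process \<mu> gauss_map digit using \<mu> by (rule stationary_process_gauss_map)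
  have "0 \<le> ln (real d)" for d by (cases d) auto
  then have "AE x in \<mu>. \<forall>e>0. \<forall>\<^sub>F n in sequentially. ln (real (digit ((gauss_map ^^ n) x))) \<le> e * real n"
    using fin by (intro AE_sublinear)
  then show ?thesis
    using AE_space
  proof eventually_elim
    case (elim x)
    then show ?case
      by (intro diophantine_if_digits_sublinear) (auto simp: space_borel_probabilities[OF \<mu>(1)] cf_digit_def)
  qed
qed

lemma digit_algebra_eq: "digit_algebra K = process_algebra irrational_unit gauss_map digit K"
  unfolding digit_algebra_def process_algebra_def ..

theorem AE_liouville:
  assumes \<mu>: "\<mu> \<in> borel_probabilities irrational_unit" "invariant_measure gauss_map \<mu>"
    and mix: "cf_mixing \<mu>" and inf: "(\<integral>\<^sup>+ x. ennreal (ln (real (digit x))) \<partial>\<mu>) = \<infinity>"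
  shows "AE x in \<mu>. liouville x"
proof -
  interpret stationary_process \<mu> gauss_map digit using \<mu> by (rule stationary_process_gauss_map)
  obtain \<theta> :: "nat \<Rightarrow> real" where \<theta>: "\<And>N. N \<ge> 1 \<Longrightarrow> \<theta> N \<ge> 0" "\<theta> \<longlonglongrightarrow> 0"
    and m: "\<And>n N A B. n \<ge> 1 \<Longrightarrow> N \<ge> 1 \<Longrightarrow> A \<in> \<F> {0..n} \<Longrightarrow> B \<in> \<F> {n+N..} \<Longrightarrow>
      \<bar>prob (A \<inter> B) - prob A * prob B\<bar> \<le> \<theta> N * prob A * prob B"
    using mix unfolding cf_mixing_def digit_algebra_eq space_borel_probabilities[OF \<mu>(1)] by blast
  have g: "ln 2 \<le> ln (real d + 2)" for d by (intro ln_mono) auto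
  interpret weighted_mixing_process \<mu> gauss_map digit \<theta> "\<lambda>d. ln (real d + 2)" "ln 2"
    using \<theta> m g by unfold_locales auto
  have "(\<integral>\<^sup>+ x. ennreal (ln (real (digit x))) \<partial>\<mu>) \<le> (\<integral>\<^sup>+ x. ennreal (X 0 x) \<partial>\<mu>)"
    unfolding X_0 by (intro nn_integral_mono ennreal_leI ln_mono)
      (auto simp: space_borel_probabilities[OF \<mu>(1)] dest: digit_pos)
  then have "(\<integral>\<^sup>+ x. ennreal (X 0 x) \<partial>\<mu>) = \<infinity>" using inf by (simp add: top_unique)
  then have "AE x in \<mu>. \<forall>K::nat. \<exists>\<^sub>F n in sequentially. real K * S n x < X n x"
    by (rule AE_exceeds_partial_sums)
  then show ?thesis
    using AE_space
  proof eventually_elim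
    case (elim x)
    then show ?case
      by (intro liouville_if_digit_exceeds_sum)
         (auto simp: space_borel_probabilities[OF \<mu>(1)] cf_digit_def S_def X_def)
  qed
qed

section \<open>Continued fractions with prescribed digits\<close>

text \<open>On rationals the Gauss map is Euclid's algorithm: p/q goes to (q mod p)/p with a smaller
  denominator, so the orbit must hit 0.\<close>

lemma Rats_gauss_map_orbit:
  assumes "x \<in> \<rat>" and pos: "\<And>n. 0 < (gauss_map ^^ n) x" and less: "x < 1"
  shows False
proof -
  have *: False if "0 < p" "p < q" "\<And>n. 0 < (gauss_map ^^ n) (real p / real q)" for p q :: nat
    using that
  proof (induction q arbitrary: p rule: less_induct)
    case (less q)
    have g: "gauss_map (real p / real q) = real (q mod p) / real p"
    proof -
      have "real q = real (q div p) * real p + real (q mod p)"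
        by (metis div_mult_mod_eq of_nat_add of_nat_mult)
      then have "real q / real p = real (q div p) + real (q mod p) / real p"
        using less.prems(1) by (simp add: field_simps)
      moreover have "\<lfloor>real q / real p\<rfloor> = int (q div p)" by (rule floor_divide_of_nat_eq)
      ultimately show ?thesis by (simp add: gauss_map_def frac_def)
    qed
    have sh: "(gauss_map ^^ n) (real (q mod p) / real p) = (gauss_map ^^ Suc n) (real p / real q)" for n
      unfolding g[symmetric] by (simp add: funpow_swap1)
    have all: "0 < (gauss_map ^^ n) (real (q mod p) / real p)" for n
      unfolding sh by (rule less.prems(3))
    from all[of 0] have "0 < q mod p" using less.prems(1) by (simp add: zero_less_divide_iff)
    then show False using less.IH[of p "q mod p"] less.prems all by simp
  qed
  have "x > 0" using pos[of 0] by simp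
  then obtain p q :: nat where pq: "q \<noteq> 0" "x = real p / real q"
    using Rats_abs_nat_div_natE[OF assms(1)] by (metis abs_of_pos)
  have "0 < p" using \<open>x > 0\<close> pq by (simp add: zero_less_divide_iff)
  moreover have "p < q" using less pq by (simp add: field_simps)
  ultimately show False using *[of p q] pos pq by simp
qed

text \<open>Recursion through the shifted digit sequence, and not through numerators and
  denominators, makes the Gauss map act on the limits as the shift.\<close>

fun cf_trunc :: "(nat \<Rightarrow> nat) \<Rightarrow> nat \<Rightarrow> real" where
  "cf_trunc a 0 = 0"
| "cf_trunc a (Suc n) = 1 / (real (a 0) + cf_trunc (\<lambda>k. a (Suc k)) n)"

definition cf_value :: "(nat \<Rightarrow> nat) \<Rightarrow> real" where
  "cf_value a = lim (cf_trunc a)"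

lemma cf_trunc_bounds:
  assumes "\<And>k. a k \<ge> 2"
  shows "0 \<le> cf_trunc a n \<and> cf_trunc a n \<le> 1/2"
  using assms
proof (induction n arbitrary: a)
  case (Suc n)
  have "0 \<le> cf_trunc (\<lambda>k. a (Suc k)) n" using Suc by simp
  moreover have "real (a 0) \<ge> 2" using Suc.prems[of 0] by simp
  ultimately show ?case by (simp add: field_simps)
qed simp

text \<open>For a digit a >= 2 the map y -> 1/(a + y) contracts nonnegative numbers by the factor
  1/4. Digit 1 would give no uniform contraction in a single step.\<close>

lemma cf_trunc_diff:
  assumes "\<And>k. a k \<ge> 2"
  shows "\<bar>cf_trunc a (Suc n) - cf_trunc a n\<bar> \<le> (1/4) ^ n"
  using assms
proof (induction n arbitrary: a)
  case 0
  have "real (a 0) \<ge> 2" using 0[of 0] by simp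
  then show ?case by (simp add: field_simps)
next
  case (Suc n)
  define y z where "y = cf_trunc (\<lambda>k. a (Suc k)) (Suc n)" and "z = cf_trunc (\<lambda>k. a (Suc k)) n"
  have b: "real (a 0) + y \<ge> 2" "real (a 0) + z \<ge> 2"
    using Suc.prems[of 0] cf_trunc_bounds[of "\<lambda>k. a (Suc k)"] Suc.prems by (auto simp: y_def z_def simp del: cf_trunc.simps intro: add_increasing2)
  have "cf_trunc a (Suc (Suc n)) - cf_trunc a (Suc n) = 1 / (real (a 0) + y) - 1 / (real (a 0) + z)"
    by (simp add: y_def z_def)
  also have "\<dots> = (z - y) / ((real (a 0) + y) * (real (a 0) + z))"
    using b by (simp add: diff_frac_eq)
  finally have "\<bar>cf_trunc a (Suc (Suc n)) - cf_trunc a (Suc n)\<bar> = \<bar>y - z\<bar> / ((real (a 0) + y) * (real (a 0) + z))"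
    using b by (simp add: abs_mult abs_minus_commute)
  also have "\<dots> \<le> \<bar>y - z\<bar> / (2 * 2)"
    using b by (intro divide_left_mono mult_mono mult_pos_pos) auto
  also have "\<dots> \<le> (1/4) ^ n / (2 * 2)"
    using Suc.IH[of "\<lambda>k. a (Suc k)"] Suc.prems unfolding y_def z_def by (intro divide_right_mono) auto
  finally show ?case by simp
qed

context
  fixes a :: "nat \<Rightarrow> nat"
  assumes a: "\<And>k. a k \<ge> 2"
begin

lemma cf_trunc_tendsto: "cf_trunc a \<longlonglongrightarrow> cf_value a"
proof -
  have "summable (\<lambda>n. cf_trunc a (Suc n) - cf_trunc a n)"
    by (rule summable_comparison_test'[OF summable_geometric[of "1/4 :: real"], of 0])
       (use cf_trunc_diff[OF a] in auto)
  then have "convergent (\<lambda>n. \<Sum>i<n. cf_trunc a (Suc i) - cf_trunc a i)"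
    by (simp add: summable_iff_convergent)
  then have "convergent (cf_trunc a)" by (simp only: sum_lessThan_telescope) simp
  then show ?thesis unfolding cf_value_def by (simp add: convergent_LIMSEQ_iff)
qed

lemma cf_value_bounds: "0 \<le> cf_value a" "cf_value a \<le> 1/2"
  using LIMSEQ_le_const[OF cf_trunc_tendsto, of 0] LIMSEQ_le_const2[OF cf_trunc_tendsto, of "1/2"]
    cf_trunc_bounds[OF a] by auto

end

lemma cf_value_rec:
  assumes a: "\<And>k. a k \<ge> 2"
  shows "cf_value a = 1 / (real (a 0) + cf_value (\<lambda>k. a (Suc k)))"
proof -
  have "(\<lambda>n. 1 / (real (a 0) + cf_trunc (\<lambda>k. a (Suc k)) n)) \<longlonglongrightarrow> 1 / (real (a 0) + cf_value (\<lambda>k. a (Suc k)))"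
  proof (intro tendsto_intros cf_trunc_tendsto)
    have "0 \<le> cf_value (\<lambda>k. a (Suc k))" using a by (intro cf_value_bounds) simp
    moreover have "real (a 0) \<ge> 2" using a[of 0] by simp
    ultimately show "real (a 0) + cf_value (\<lambda>k. a (Suc k)) \<noteq> 0" by linarith
  qed (use a in simp)
  then have "(\<lambda>n. cf_trunc a (Suc n)) \<longlonglongrightarrow> 1 / (real (a 0) + cf_value (\<lambda>k. a (Suc k)))" by simp
  then have "cf_trunc a \<longlonglongrightarrow> 1 / (real (a 0) + cf_value (\<lambda>k. a (Suc k)))" by (rule LIMSEQ_imp_Suc)
  then show ?thesis using cf_trunc_tendsto[of a] a LIMSEQ_unique by blast
qed

text \<open>The tail value lies in [0, 1/2], so it is exactly the fractional part of the
  reciprocal.\<close>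

lemma cf_value_digit_gauss_map:
  assumes a: "\<And>k. a k \<ge> 2"
  shows "cf_value a > 0" "digit (cf_value a) = a 0" "gauss_map (cf_value a) = cf_value (\<lambda>k. a (Suc k))"
proof -
  define y where "y = cf_value (\<lambda>k. a (Suc k))"
  have y: "0 \<le> y" "y \<le> 1/2" unfolding y_def using a by (intro cf_value_bounds; simp)+
  have a0: "real (a 0) \<ge> 2" using a[of 0] by simp
  have v: "cf_value a = 1 / (real (a 0) + y)" unfolding y_def by (rule cf_value_rec[OF a])
  then have inv: "1 / cf_value a = real (a 0) + y" using y a0 by simp
  have fl: "\<lfloor>real (a 0) + y\<rfloor> = int (a 0)" using y by linarith
  show "cf_value a > 0" using v y a0 by simp
  show "digit (cf_value a) = a 0" unfolding digit_def inv fl by simp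
  show "gauss_map (cf_value a) = cf_value (\<lambda>k. a (Suc k))"
    unfolding gauss_map_def inv frac_def fl by (simp add: y_def)
qed

lemma funpow_gauss_map_cf_value:
  assumes a: "\<And>k. a k \<ge> 2"
  shows "(gauss_map ^^ n) (cf_value a) = cf_value (\<lambda>k. a (n + k))"
  by (induction n) (use a in \<open>auto simp: cf_value_digit_gauss_map\<close>)

lemma cf_digit_cf_value:
  assumes a: "\<And>k. a k \<ge> 2"
  shows "cf_digit (cf_value a) n = a n"
  using cf_value_digit_gauss_map(2)[of "\<lambda>k. a (n + k)"] a
  by (simp add: cf_digit_def funpow_gauss_map_cf_value)

lemma cf_value_irrational_unit:
  assumes a: "\<And>k. a k \<ge> 2"
  shows "cf_value a \<in> irrational_unit"
proof (rule irrational_unitI)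
  show "cf_value a < 1" using cf_value_bounds(2)[of a] a by simp
  moreover have "0 < (gauss_map ^^ n) (cf_value a)" for n
    using cf_value_digit_gauss_map(1)[of "\<lambda>k. a (n + k)"] a by (simp add: funpow_gauss_map_cf_value)
  ultimately show "cf_value a \<notin> \<rat>" using Rats_gauss_map_orbit by blast
qed (use cf_value_digit_gauss_map(1) a in auto)

text \<open>On bounded inputs \<open>peak w\<close> is the supremum of \<open>w k - k\<close>, truncated at \<open>0\<close>.\<close>

definition peak_bounded :: "(nat \<Rightarrow> nat) \<Rightarrow> bool" where
  "peak_bounded w \<longleftrightarrow> (\<exists>B. \<forall>k. w k \<le> B + k)"

definition peak :: "(nat \<Rightarrow> nat) \<Rightarrow> nat" where
  "peak w = (if peak_bounded w then LEAST B. \<forall>k. w k \<le> B + k else 0)"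

lemma le_peak: "peak_bounded w \<Longrightarrow> w k \<le> peak w + k"
  unfolding peak_def peak_bounded_def using LeastI_ex[of "\<lambda>B. \<forall>k. w k \<le> B + k"] by auto

lemma peak_le: "(\<And>k. w k \<le> B + k) \<Longrightarrow> peak w \<le> B"
  unfolding peak_def peak_bounded_def by (auto intro: Least_le)

lemma peak_bounded_shift: "peak_bounded (\<lambda>k. w (n + k)) \<longleftrightarrow> peak_bounded w"
proof
  assume "peak_bounded w"
  then obtain B where B: "\<And>k. w k \<le> B + k" by (auto simp: peak_bounded_def)
  have "w (n + k) \<le> (B + n) + k" for k using B[of "n + k"] by (simp add: add.assoc)
  then show "peak_bounded (\<lambda>k. w (n + k))" unfolding peak_bounded_def by blast
next
  assume "peak_bounded (\<lambda>k. w (n + k))"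
  then obtain B where B: "\<And>k. w (n + k) \<le> B + k" by (auto simp: peak_bounded_def)
  have "w k \<le> (B + (\<Sum>i<n. w i)) + k" for k
  proof (cases "k < n")
    case True
    then have "w k \<le> (\<Sum>i<n. w i)" by (intro member_le_sum) auto
    then show ?thesis by simp
  next
    case False
    then show ?thesis using B[of "k - n"] by simp
  qed
  then show "peak_bounded w" unfolding peak_bounded_def by blast
qed

text \<open>Reading the bound for \<open>w (n + k)\<close> at \<open>Suc k\<close> raises the
  constant by one. Boundedness does not depend on the shift, so in the unbounded case both peaks
  take the default value 0.\<close>

lemma peak_Suc_le: "peak (\<lambda>k. w (Suc n + k)) \<le> peak (\<lambda>k. w (n + k)) + 1"
proof (cases "peak_bounded w")
  case True
  then have b: "peak_bounded (\<lambda>k. w (n + k))" by (simp add: peak_bounded_shift)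
  show ?thesis using le_peak[OF b, of "Suc _"] by (intro peak_le) simp
next
  case False
  then have "\<not> peak_bounded (\<lambda>k. w (Suc n + k))" unfolding peak_bounded_shift .
  then show ?thesis by (simp add: peak_def)
qed

text \<open>The supremum seen from m is governed either by positions before n, where it is at most
  R, or by positions from n on, where it is the peak at n lowered by the distance n - m. The second
  alternative is the ramp that leads up to n.\<close>

lemma peak_before:
  assumes bdd: "peak_bounded w" and m: "m < n" and R: "\<And>k. k < n \<Longrightarrow> w k \<le> R"
  shows "peak (\<lambda>k. w (m + k)) + (n - m) \<le> peak (\<lambda>k. w (n + k)) \<or> peak (\<lambda>k. w (m + k)) \<le> R"
proof -
  define p where "p = peak (\<lambda>k. w (n + k))"
  have b: "peak_bounded (\<lambda>k. w (n + k))" using bdd by (simp add: peak_bounded_shift)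
  have "peak (\<lambda>k. w (m + k)) \<le> max R (p - (n - m))"
  proof (rule peak_le)
    fix k
    show "w (m + k) \<le> max R (p - (n - m)) + k"
    proof (cases "m + k < n")
      case True
      then show ?thesis using R[of "m + k"] by simp
    next
      case False
      have "w (m + k) \<le> p + (m + k - n)" using le_peak[OF b, of "m + k - n"] False by (simp add: p_def)
      then show ?thesis using False m by simp
    qed
  qed
  then show ?thesis unfolding p_def[symmetric] by linarith
qed

text \<open>The geometric series is multiplied through by r so that r = 0 is covered.\<close>

lemma sum_inverse_powers:
  fixes r :: real
  assumes "r \<ge> 0"
  shows "r * (\<Sum>i<n. 1 / (1 + r) ^ Suc i) = 1 - 1 / (1 + r) ^ n"
proof (induction n)
  case (Suc n)
  have "r * (\<Sum>i<Suc n. 1 / (1 + r) ^ Suc i) = 1 - 1 / (1 + r) ^ n + r / (1 + r) ^ Suc n"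
    using Suc by (simp add: distrib_left)
  also have "1 / (1 + r) ^ n = (1 + r) / (1 + r) ^ Suc n" using assms by simp
  finally show ?case using assms by (simp add: diff_divide_distrib[symmetric] add_divide_distrib)
qed simp

lemma ln_cf_denom_ge_sum:
  assumes a: "\<And>k. a k \<ge> 1"
  shows "(\<Sum>k<n. ln (real (a k))) \<le> ln (real (cf_denom a n))"
proof (induction n)
  case (Suc n)
  have q: "cf_denom a n \<ge> 1" by (rule cf_denom_pos[OF a])
  have "ln (real (a n)) + ln (real (cf_denom a n)) = ln (real (a n * cf_denom a n))"
    using q a[of n] by (simp add: ln_mult)
  also have "\<dots> \<le> ln (real (cf_denom a (Suc n)))"
    using q a[of n] cf_denom_Suc_ge[of a n, OF a] by (intro ln_mono) (auto simp del: of_nat_mult)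
  finally show ?case using Suc by simp
qed simp

text \<open>The ratio bound read backwards gives X_(n-i) >= X_n/(1+r)^i, so the last k log-digits
  alone sum to at least \<sigma>_k X_n. Since r \<sigma>_k = 1 - (1+r)^-k, a large k achieves t
  \<sigma>_k > 1 for any t > r, and the surplus pays for the rounding error ln 2.\<close>

lemma digits_le_if_ratio_le:
  fixes a :: "nat \<Rightarrow> nat" and X :: "nat \<Rightarrow> real"
  assumes r: "r \<ge> 0" and a: "\<And>k. a k \<ge> 1" and X1: "\<And>n. X n \<ge> 1"
    and step: "\<And>n. X (Suc n) \<le> (1 + r) * X n"
    and Xa: "\<And>n. X n \<le> ln (real (a n))" "\<And>n. ln (real (a n)) \<le> X n + ln 2"
    and t: "t > r"
  shows "\<forall>\<^sub>F n in sequentially. ln (real (a n)) \<le> t * ln (real (cf_denom a n))"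
proof -
  define \<sigma> where "\<sigma> k = (\<Sum>i<k. 1 / (1 + r) ^ Suc i)" for k
  \<comment> \<open>As \<sigma>_k >= k (1+r)^-k, this k gives (t - r) \<sigma>_k > (1+r)^-k, which
    is the same as t \<sigma>_k > 1. The argument includes r = 0.\<close>
  obtain k :: nat where k: "1 / (t - r) < real k" using reals_Archimedean2 by blast
  have "real k * (1 / (1 + r) ^ k) \<le> \<sigma> k"
  proof -
    have "(\<Sum>i<k. 1 / (1 + r) ^ k) \<le> \<sigma> k"
      unfolding \<sigma>_def using r by (intro sum_mono divide_left_mono power_increasing mult_pos_pos) auto
    then show ?thesis by simp
  qed
  then have "(t - r) * (real k * (1 / (1 + r) ^ k)) \<le> (t - r) * \<sigma> k"
    using t by (intro mult_left_mono) auto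
  moreover have "1 < (t - r) * real k" using k t by (simp add: field_simps)
  then have "1 * (1 / (1 + r) ^ k) < (t - r) * real k * (1 / (1 + r) ^ k)"
    using r by (intro mult_strict_right_mono) auto
  ultimately have "1 / (1 + r) ^ k < (t - r) * \<sigma> k" by (simp add: mult.assoc)
  then have "1 < t * \<sigma> k"
    using sum_inverse_powers[OF r, of k] unfolding \<sigma>_def[symmetric] by (simp add: algebra_simps)
  define \<delta> where "\<delta> = t * \<sigma> k - 1"
  have \<delta>: "\<delta> > 0" using \<open>1 < t * \<sigma> k\<close> by (simp add: \<delta>_def)
  have past: "X n / (1 + r) ^ i \<le> X (n - i)" if "i \<le> n" for n i
    using that
  proof (induction i)
    case (Suc i)
    have "X n \<le> (1 + r) ^ i * X (n - i)" using Suc r by (simp add: field_simps)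
    also have "X (n - i) \<le> (1 + r) * X (n - Suc i)"
      using step[of "n - Suc i"] Suc.prems by (simp add: Suc_diff_Suc)
    finally have "X n \<le> (1 + r) ^ i * ((1 + r) * X (n - Suc i))" using r by (simp add: mult_left_mono)
    then have "X n \<le> X (n - Suc i) * (1 + r) ^ Suc i" by (simp add: mult_ac)
    then show ?case using r by (subst pos_divide_le_eq) auto
  qed simp
  have lower: "\<sigma> k * X n \<le> ln (real (cf_denom a n))" if n: "k \<le> n" for n
  proof -
    have "\<sigma> k * X n = (\<Sum>i<k. X n / (1 + r) ^ Suc i)" by (simp add: \<sigma>_def sum_distrib_right)
    also have "\<dots> \<le> (\<Sum>i<k. X (n - Suc i))" using n by (intro sum_mono past) auto
    also have "\<dots> \<le> (\<Sum>i<n. X (n - Suc i))"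
      using n X1 by (intro sum_mono2) (auto intro: order_trans[OF zero_le_one])
    also have "\<dots> = (\<Sum>i<n. X i)" by (rule sum.nat_diff_reindex)
    also have "\<dots> \<le> (\<Sum>i<n. ln (real (a i)))" using Xa(1) by (intro sum_mono)
    also have "\<dots> \<le> ln (real (cf_denom a n))" by (rule ln_cf_denom_ge_sum[OF a])
    finally show ?thesis .
  qed
  have n_le: "real n \<le> ln (real (cf_denom a n))" for n
  proof -
    have "real n \<le> (\<Sum>i<n. ln (real (a i)))"
      using sum_mono[of "{..<n}" "\<lambda>_. 1" "\<lambda>i. ln (real (a i))"] X1 Xa(1) by (auto intro: order_trans)
    then show ?thesis using ln_cf_denom_ge_sum[of a n, OF a] by linarith
  qed
  \<comment> \<open>Where X_n is too small for the surplus to cover ln 2, the log-digit is bounded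
    by a constant and is beaten by ln q_n >= n.\<close>
  obtain N :: nat where N: "(ln 2 / \<delta> + ln 2) / t \<le> real N" using real_arch_simple by blast
  have "ln (real (a n)) \<le> t * ln (real (cf_denom a n))" if n: "n \<ge> max k N" for n
  proof (cases "ln 2 \<le> \<delta> * X n")
    case True
    have "ln (real (a n)) \<le> X n + \<delta> * X n" using True Xa(2)[of n] by linarith
    also have "\<dots> = t * (\<sigma> k * X n)" by (simp add: \<delta>_def algebra_simps)
    also have "\<dots> \<le> t * ln (real (cf_denom a n))" using n lower t r by (intro mult_left_mono) auto
    finally show ?thesis .
  next
    case False
    then have "X n \<le> ln 2 / \<delta>" using \<delta> by (simp add: field_simps)
    then have "ln (real (a n)) \<le> ln 2 / \<delta> + ln 2" using Xa(2)[of n] by linarith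
    also have "\<dots> \<le> t * real N" using N t r by (simp add: field_simps)
    also have "\<dots> \<le> t * real n" using n t r by (intro mult_left_mono) auto
    also have "\<dots> \<le> t * ln (real (cf_denom a n))" using n_le t r by (intro mult_left_mono) auto
    finally show ?thesis .
  qed
  then show ?thesis by (rule eventually_sequentiallyI)
qed

text \<open>The ramp below its top is a geometric series of sum at most 1/r. Z bounds the
  contribution of older peaks to a single digit, and the 2 covers both rounding and the passage from
  a_k to a_k + 1.\<close>

lemma ln_cf_denom_le_at_ramp_top:
  fixes a :: "nat \<Rightarrow> nat" and X :: "nat \<Rightarrow> real"
  assumes r: "r > 0" and a: "\<And>k. a k \<ge> 1" and X: "X n \<ge> 0"
    and Xa: "\<And>n. ln (real (a n) + 1) \<le> X n + 2"
    and ramp: "\<And>m. m < n \<Longrightarrow> X m \<le> X n / (1 + r) ^ (n - m) + Z"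
  shows "ln (real (cf_denom a n)) \<le> X n / r + real n * (Z + 2)"
proof -
  have "ln (real (cf_denom a n)) \<le> (\<Sum>k<n. ln (real (a k) + 1))"
    by (rule ln_cf_denom_le_sum[OF a])
  also have "\<dots> \<le> (\<Sum>k<n. X n / (1 + r) ^ (n - k) + (Z + 2))"
    using ramp Xa by (intro sum_mono) (smt (verit) lessThan_iff)
  also have "\<dots> = (\<Sum>k<n. X n / (1 + r) ^ (n - k)) + real n * (Z + 2)"
    by (simp add: sum.distrib)
  also have "(\<Sum>k<n. X n / (1 + r) ^ (n - k)) = (\<Sum>k<n. X n / (1 + r) ^ (n - (n - Suc k)))"
    by (rule sum.nat_diff_reindex[symmetric])
  also have "\<dots> = (\<Sum>k<n. X n / (1 + r) ^ Suc k)"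
    by (intro sum.cong refl) (simp add: Suc_diff_Suc)
  also have "\<dots> = X n * (\<Sum>k<n. 1 / (1 + r) ^ Suc k)" by (simp add: sum_distrib_left)
  also have "\<dots> \<le> X n * (1 / r)"
  proof (intro mult_left_mono X)
    have "r * (\<Sum>k<n. 1 / (1 + r) ^ Suc k) \<le> 1"
      using r by (subst sum_inverse_powers) auto
    then show "(\<Sum>k<n. 1 / (1 + r) ^ Suc k) \<le> 1 / r" using r by (simp add: field_simps)
  qed
  finally show ?thesis by simp
qed

section \<open>An ergodic measure with prescribed irrationality exponent\<close>

text \<open>The parameter 3/4 gives the weights (3/4) 4^-j: 4 exceeds 2, so 2^J is integrable, and
  is below 16, so a value >= j typically occurs before time 16^j.\<close>

definition geometric_seq :: "(nat \<Rightarrow> nat) measure" where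
  "geometric_seq = (\<Pi>\<^sub>M i\<in>UNIV. measure_pmf (geometric_pmf (3/4)))"

definition seq_shift :: "(nat \<Rightarrow> nat) \<Rightarrow> nat \<Rightarrow> nat" where
  "seq_shift \<omega> = (\<lambda>n. \<omega> (Suc n))"

lemma space_geometric_seq[simp]: "space geometric_seq = UNIV"
  by (simp add: geometric_seq_def space_PiM)

lemma measurable_geometric_seq_component[measurable]:
  "(\<lambda>\<omega>. \<omega> k) \<in> measurable geometric_seq (count_space UNIV)"
  unfolding geometric_seq_def measurable_pmf_measure2[symmetric, of _ "geometric_pmf (3/4)"]
  by (rule measurable_component_singleton) simp

lemmas geometric_seq_component = measurable_geometric_seq_component[unfolded geometric_seq_def]

lemma funpow_seq_shift: "(seq_shift ^^ n) \<omega> = (\<lambda>k. \<omega> (n + k))"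
  by (induction n) (auto simp: seq_shift_def)

interpretation geometric_seq: stationary_process geometric_seq seq_shift "\<lambda>\<omega>. \<omega> 0"
proof -
  interpret prob_space geometric_seq
    unfolding geometric_seq_def by (rule prob_space_PiM) (rule prob_space_measure_pmf)
  have T: "seq_shift \<in> measurable geometric_seq geometric_seq"
    unfolding seq_shift_def[abs_def] geometric_seq_def
    by (rule measurable_PiM_single') (auto intro: geometric_seq_component)
  have "distr geometric_seq geometric_seq seq_shift = geometric_seq"
    using distr_PiM_reindex[of UNIV "\<lambda>_. measure_pmf (geometric_pmf (3/4))" Suc UNIV]
    by (simp add: geometric_seq_def seq_shift_def[abs_def] prob_space_measure_pmf restrict_def)
  then show "stationary_process geometric_seq seq_shift (\<lambda>\<omega>. \<omega> 0)"
    using T by unfold_locales auto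
qed

text \<open>A strictly invariant set equals all its preimages under powers of the shift, so it
  depends only on coordinates from n on, for every n. Kolmogorov's law for the independent
  coordinates then decides its probability.\<close>

lemma geometric_seq_invariant_0_1:
  assumes B: "B \<in> sets geometric_seq" and inv: "\<And>\<omega>. seq_shift \<omega> \<in> B \<longleftrightarrow> \<omega> \<in> B"
  shows "geometric_seq.prob B = 0 \<or> geometric_seq.prob B = 1"
proof -
  define A where "A i = {(\<lambda>\<omega> :: nat \<Rightarrow> nat. \<omega> i) -` S | S. True}" for i :: nat
  have sub: "geometric_seq.\<F> K = sigma_sets UNIV (\<Union> (A ` K))" for K
    by (simp add: process_algebra_def A_def comp_def funpow_seq_shift)
  have id: "(\<lambda>\<omega>. \<omega>) \<in> measurable (geometric_seq.\<F>M UNIV) (\<Pi>\<^sub>M i\<in>UNIV. measure_pmf (geometric_pmf (3/4)))"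
  proof (rule measurable_PiM_single')
    fix i
    show "(\<lambda>\<omega>. \<omega> i) \<in> measurable (geometric_seq.\<F>M UNIV) (measure_pmf (geometric_pmf (3/4)))"
      using geometric_seq.measurable_Y_\<F>M[of i UNIV]
      by (simp add: funpow_seq_shift cong: measurable_cong_sets)
  qed auto
  have BF: "B \<in> geometric_seq.\<F> UNIV"
    using measurable_sets[OF id B[unfolded geometric_seq_def]] by simp
  have "(seq_shift ^^ n) \<omega> \<in> B \<longleftrightarrow> \<omega> \<in> B" for n \<omega>
    by (induction n) (auto simp: inv)
  then have "(seq_shift ^^ n) -` B = B" for n by auto
  then have "B \<in> geometric_seq.\<F> {n..}" for n
    using geometric_seq.vimage_funpow_\<F>[OF BF, of n] by simp
  then have tail: "B \<in> geometric_seq.tail_events A"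
    unfolding geometric_seq.tail_events_def sub by simp
  have indep: "geometric_seq.indep_vars (\<lambda>_. measure_pmf (geometric_pmf (3/4))) (\<lambda>i \<omega>. \<omega> i) UNIV"
  proof -
    have "distr geometric_seq (measure_pmf (geometric_pmf (3/4))) (\<lambda>\<omega>. \<omega> i) = measure_pmf (geometric_pmf (3/4))" for i
      unfolding geometric_seq_def by (rule distr_PiM_component) (auto simp: prob_space_measure_pmf)
    then have "distr geometric_seq (\<Pi>\<^sub>M i\<in>UNIV. measure_pmf (geometric_pmf (3/4))) (\<lambda>x. \<lambda>i\<in>UNIV. x i)
      = (\<Pi>\<^sub>M i\<in>UNIV. distr geometric_seq (measure_pmf (geometric_pmf (3/4))) (\<lambda>\<omega>. \<omega> i))"
      by (simp add: geometric_seq_def[symmetric] restrict_def)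
    then show ?thesis
      by (subst geometric_seq.indep_vars_iff_distr_eq_PiM') auto
  qed
  have "geometric_seq.indep_sets A UNIV"
    using indep unfolding geometric_seq.indep_vars_def2 A_def[abs_def] by simp
  moreover have "sigma_algebra (space geometric_seq) (A i)" for i
  proof -
    have "A i = sets (vimage_algebra UNIV (\<lambda>\<omega>. \<omega> i) (count_space UNIV))"
      by (auto simp: A_def sets_vimage_algebra2)
    then show ?thesis using sets.sigma_algebra_axioms[of "vimage_algebra UNIV (\<lambda>\<omega>::nat\<Rightarrow>nat. \<omega> i) (count_space UNIV)"]
      by simp
  qed
  ultimately show ?thesis using geometric_seq.kolmogorov_0_1_law[of A B] tail by blast
qed

text \<open>E(2^J) is the sum of (3/4) 2^-n, hence finite. So the heights are eventually at most
  their index, and the finitely many others are covered by a constant.\<close>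

lemma AE_peak_bounded: "AE \<omega> in geometric_seq. peak_bounded (\<lambda>k. 2 ^ \<omega> k)"
proof -
  have pmf: "ennreal (pmf (geometric_pmf (3/4)) n) * ennreal (2 ^ n) = ennreal (3/4 * (1/2) ^ n)" for n
  proof -
    have "pmf (geometric_pmf (3/4)) n * 2 ^ n = 3/4 * ((1/4) ^ n * 2 ^ n)" by simp
    also have "(1/4) ^ n * 2 ^ n = (1/2 :: real) ^ n" by (simp add: power_mult_distrib[symmetric])
    finally show ?thesis by (simp add: ennreal_mult[symmetric])
  qed
  have "(\<integral>\<^sup>+ \<omega>. ennreal (2 ^ \<omega> 0) \<partial>geometric_seq)
      = (\<integral>\<^sup>+ d. ennreal (2 ^ d) \<partial>distr geometric_seq (measure_pmf (geometric_pmf (3/4))) (\<lambda>\<omega>. \<omega> 0))"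
    by (rule nn_integral_distr[symmetric]) (auto simp: geometric_seq_def intro: geometric_seq_component)
  also have "distr geometric_seq (measure_pmf (geometric_pmf (3/4))) (\<lambda>\<omega>. \<omega> 0) = measure_pmf (geometric_pmf (3/4))"
    unfolding geometric_seq_def by (rule distr_PiM_component) (auto simp: prob_space_measure_pmf)
  also have "(\<integral>\<^sup>+ d. ennreal (2 ^ d) \<partial>measure_pmf (geometric_pmf (3/4))) = (\<Sum>n. ennreal (3/4 * (1/2) ^ n))"
    by (simp only: nn_integral_measure_pmf nn_integral_count_space_nat pmf)
  also have "\<dots> < \<infinity>"
  proof -
    have "summable (\<lambda>n. 3/4 * (1/2 :: real) ^ n)" by (intro summable_mult summable_geometric) simp
    then have "(\<Sum>n. ennreal (3/4 * (1/2) ^ n)) \<noteq> top" by (rule ennreal_suminf_neq_top) simp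
    then show ?thesis unfolding infinity_ennreal_def by (rule less_top[THEN iffD1])
  qed
  finally have "AE \<omega> in geometric_seq. \<forall>e>0. \<forall>\<^sub>F n in sequentially. 2 ^ ((seq_shift ^^ n) \<omega> 0) \<le> e * real n"
    by (intro geometric_seq.AE_sublinear) auto
  then show ?thesis
  proof (rule AE_mp, intro AE_I2 impI)
    fix \<omega> :: "nat \<Rightarrow> nat"
    assume "\<forall>e>0. \<forall>\<^sub>F n in sequentially. 2 ^ ((seq_shift ^^ n) \<omega> 0) \<le> e * real n"
    from this[rule_format, of 1] obtain N where N: "\<And>n. n \<ge> N \<Longrightarrow> 2 ^ \<omega> n \<le> real n"
      by (auto simp: funpow_seq_shift eventually_sequentially)
    have "(2 :: nat) ^ \<omega> k \<le> (\<Sum>i<N. 2 ^ \<omega> i) + k" for k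
    proof (cases "k < N")
      case True
      then have "(2 :: nat) ^ \<omega> k \<le> (\<Sum>i<N. 2 ^ \<omega> i)" by (intro member_le_sum) auto
      then show ?thesis by simp
    next
      case False
      then have "real (2 ^ \<omega> k) \<le> real k" using N[of k] by simp
      then show ?thesis unfolding of_nat_le_iff by simp
    qed
    then show "peak_bounded (\<lambda>k. 2 ^ \<omega> k)" unfolding peak_bounded_def by blast
  qed
qed

text \<open>With N = 16^j and p = P(J = j), all of the first N values stay below j with probability
  at most (1 - p)^N <= exp (- N p) <= 1/(N p). Here N p = (3/4) 4^j, so these bounds are
  summable.\<close>

lemma AE_early_large_values:
  "AE \<omega> in geometric_seq. \<forall>\<^sub>F j in sequentially. \<exists>n<16 ^ j. j \<le> \<omega> n"
proof -
  define B where "B j = {\<omega> :: nat \<Rightarrow> nat. \<forall>n<16 ^ j. \<omega> n < j}" for j :: nat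
  have [measurable]: "B j \<in> sets geometric_seq" for j
  proof -
    have "{\<omega> \<in> space geometric_seq. \<forall>n<16 ^ j. \<omega> n < j} \<in> sets geometric_seq" by measurable
    then show ?thesis by (simp add: B_def)
  qed
  have le: "geometric_seq.prob (B j) \<le> 4/3 * (1/4) ^ j" for j
  proof -
    define p where "p = pmf (geometric_pmf (3/4)) j"
    define q where "q = measure (measure_pmf (geometric_pmf (3/4))) {..<j}"
    define N :: nat where "N = 16 ^ j"
    have p: "p = 3/4 * (1/4) ^ j" by (simp add: p_def)
    have "q \<le> measure (measure_pmf (geometric_pmf (3/4))) (UNIV - {j})"
      unfolding q_def by (intro measure_pmf.finite_measure_mono) auto
    also have "\<dots> = 1 - p" unfolding p_def
      using measure_pmf.prob_compl[of "{j}" "geometric_pmf (3/4)"] by (simp add: measure_pmf_single)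
    finally have q: "q \<le> 1 - p" .
    have "B j = prod_emb UNIV (\<lambda>_. measure_pmf (geometric_pmf (3/4))) {..<N} (\<Pi>\<^sub>E i\<in>{..<N}. {..<j})"
      by (auto simp: B_def prod_emb_def N_def PiE_def Pi_def)
    then have "emeasure geometric_seq (B j) = (\<Prod>i\<in>{..<N}. emeasure (measure_pmf (geometric_pmf (3/4))) {..<j})"
      unfolding geometric_seq_def by (simp only:) (rule emeasure_PiM_emb, auto simp: prob_space_measure_pmf)
    also have "\<dots> = ennreal (q ^ N)"
      by (simp add: measure_pmf.emeasure_eq_measure q_def ennreal_power)
    finally have "geometric_seq.prob (B j) = q ^ N"
      by (simp add: geometric_seq.emeasure_eq_measure q_def)
    also have "\<dots> \<le> exp (- p) ^ N"
      using q exp_ge_add_one_self[of "- p"] by (intro power_mono) (auto simp: q_def)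
    also have "\<dots> = 1 / exp (real N * p)"
      unfolding exp_of_nat_mult[symmetric] by (simp add: exp_minus divide_inverse)
    also have "\<dots> \<le> 1 / (real N * p)"
    proof (rule divide_left_mono)
      show "real N * p \<le> exp (real N * p)" using exp_ge_add_one_self[of "real N * p"] by linarith
    qed (auto simp: N_def p)
    also have "real N * p = 3/4 * (16 ^ j * (1/4) ^ j)" by (simp add: N_def p)
    also have "16 ^ j * (1/4) ^ j = (4 :: real) ^ j" by (simp add: power_mult_distrib[symmetric])
    finally show ?thesis by (simp add: power_one_over)
  qed
  have "summable (\<lambda>j. geometric_seq.prob (B j))"
    by (rule summable_comparison_test'[of "\<lambda>j. 4/3 * (1/4 :: real) ^ j" 0]) (use le in \<open>auto intro!: summable_mult\<close>)
  then have "AE \<omega> in geometric_seq. \<forall>\<^sub>F j in sequentially. \<omega> \<in> space geometric_seq - B j"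
    by (intro borel_cantelli_AE1) (auto simp: geometric_seq.emeasure_eq_measure)
  then show ?thesis
    by (rule AE_mp) (auto intro!: AE_I2 elim!: eventually_mono simp: B_def not_less)
qed

section \<open>Digits that climb geometrically towards random peaks\<close>

context
  fixes r :: real
  assumes r: "r \<ge> 0"
begin

definition log_ramp :: "(nat \<Rightarrow> nat) \<Rightarrow> nat \<Rightarrow> real" where
  "log_ramp \<omega> n = (1 + r) ^ peak (\<lambda>k. 2 ^ \<omega> (n + k))"

definition ramp_digit :: "(nat \<Rightarrow> nat) \<Rightarrow> nat \<Rightarrow> nat" where
  "ramp_digit \<omega> n = nat \<lceil>exp (log_ramp \<omega> n)\<rceil>"

definition ramp_point :: "(nat \<Rightarrow> nat) \<Rightarrow> real" where
  "ramp_point \<omega> = cf_value (ramp_digit \<omega>)"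

lemma log_ramp_ge_1: "log_ramp \<omega> n \<ge> 1"
  unfolding log_ramp_def using r by (intro one_le_power) auto

lemma log_ramp_Suc: "log_ramp \<omega> (Suc n) \<le> (1 + r) * log_ramp \<omega> n"
proof -
  have "log_ramp \<omega> (Suc n) \<le> (1 + r) ^ (peak (\<lambda>k. 2 ^ \<omega> (n + k)) + 1)"
    unfolding log_ramp_def using r peak_Suc_le[of "\<lambda>k. 2 ^ \<omega> k" n] by (intro power_increasing) auto
  then show ?thesis by (simp add: log_ramp_def)
qed

lemma ramp_digit_bounds:
  "exp (log_ramp \<omega> n) \<le> real (ramp_digit \<omega> n)" "real (ramp_digit \<omega> n) \<le> exp (log_ramp \<omega> n) + 1"
proof -
  have "exp (log_ramp \<omega> n) > 0" by simp
  then show "exp (log_ramp \<omega> n) \<le> real (ramp_digit \<omega> n)" "real (ramp_digit \<omega> n) \<le> exp (log_ramp \<omega> n) + 1"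
    unfolding ramp_digit_def by linarith+
qed

lemma exp_log_ramp_ge: "exp (log_ramp \<omega> n) \<ge> 2"
  using exp_ge_add_one_self[of "log_ramp \<omega> n"] log_ramp_ge_1[of \<omega> n] by linarith

lemma ramp_digit_ge_2: "ramp_digit \<omega> n \<ge> 2"
  using ramp_digit_bounds(1)[of \<omega> n] exp_log_ramp_ge[of \<omega> n] by linarith

lemma ln_ramp_digit:
  "log_ramp \<omega> n \<le> ln (real (ramp_digit \<omega> n))"
  "ln (real (ramp_digit \<omega> n)) \<le> log_ramp \<omega> n + ln 2"
  "ln (real (ramp_digit \<omega> n) + 1) \<le> log_ramp \<omega> n + 2"
proof -
  have pos: "real (ramp_digit \<omega> n) > 0" using ramp_digit_ge_2[of \<omega> n] by simp
  show "log_ramp \<omega> n \<le> ln (real (ramp_digit \<omega> n))"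
    using ramp_digit_bounds(1)[of \<omega> n] pos by (simp add: ln_ge_iff)
  have "ln (real (ramp_digit \<omega> n)) \<le> ln (exp (log_ramp \<omega> n) * 2)"
    using ramp_digit_bounds(2)[of \<omega> n] exp_log_ramp_ge[of \<omega> n] pos by (intro ln_mono) auto
  then show "ln (real (ramp_digit \<omega> n)) \<le> log_ramp \<omega> n + ln 2" by (simp add: ln_mult)
  have "real (ramp_digit \<omega> n) + 1 \<le> exp (log_ramp \<omega> n) * 2"
    using ramp_digit_bounds(2)[of \<omega> n] exp_log_ramp_ge[of \<omega> n] by linarith
  also have "\<dots> \<le> exp (log_ramp \<omega> n) * exp 2"
    using exp_ge_add_one_self[of "2 :: real"] by (intro mult_left_mono) auto
  also have "\<dots> = exp (log_ramp \<omega> n + 2)" by (simp add: exp_add)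
  finally have "ln (real (ramp_digit \<omega> n) + 1) \<le> ln (exp (log_ramp \<omega> n + 2))"
    using pos by (intro ln_mono) auto
  then show "ln (real (ramp_digit \<omega> n) + 1) \<le> log_ramp \<omega> n + 2" by simp
qed

lemma ramp_digit_le:
  "t > r \<Longrightarrow> \<forall>\<^sub>F n in sequentially. ln (real (ramp_digit \<omega> n)) \<le> t * ln (real (cf_denom (ramp_digit \<omega>) n))"
  using ramp_digit_ge_2 log_ramp_ge_1 log_ramp_Suc ln_ramp_digit
  by (intro digits_le_if_ratio_le[where X = "log_ramp \<omega>", OF r]) (auto intro: order_trans[of _ 2])

text \<open>With u = 2^i the left side is u^4, and u/x^u tends to 0 for x the fourth root of 1 +
  r.\<close>

lemma power_tower_dominates:
  assumes "r > 0" "d > 0"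
  shows "\<forall>\<^sub>F i in sequentially. 16 ^ i \<le> d * (1 + r) ^ 2 ^ i"
proof -
  define x where "x = root 4 (1 + r)"
  have x: "x > 1" "x ^ 4 = 1 + r" using assms by (auto simp: x_def)
  have "(\<lambda>u. real u / x ^ u) \<longlonglongrightarrow> 0" using x by (intro lim_n_over_pown) auto
  then have "(\<lambda>u. (real u / x ^ u) ^ 4) \<longlonglongrightarrow> 0 ^ 4" by (rule tendsto_power)
  then have "\<forall>\<^sub>F u in sequentially. (real u / x ^ u) ^ 4 < d" using assms by (intro order_tendstoD) auto
  moreover have "filterlim (\<lambda>i::nat. 2 ^ i :: nat) sequentially sequentially"
    by (rule filterlim_subseq) (auto simp: strict_mono_def)
  ultimately have "\<forall>\<^sub>F i in sequentially. (real (2 ^ i) / x ^ 2 ^ i) ^ 4 < d"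
    by (rule eventually_compose_filterlim)
  then show ?thesis
  proof eventually_elim
    case (elim i)
    have "(2 :: real) ^ (i * 4) = 16 ^ i" by (simp add: power_mult mult.commute[of i])
    then have "(real (2 ^ i) / x ^ 2 ^ i) ^ 4 = 16 ^ i / (x ^ 4) ^ 2 ^ i"
      by (simp add: power_divide power_mult[symmetric] mult.commute)
    then have "16 ^ i / (1 + r) ^ 2 ^ i < d" using elim unfolding x by simp
    then have "16 ^ i < d * (1 + r) ^ 2 ^ i" using assms by (subst (asm) pos_divide_less_eq) auto
    then show ?case by simp
  qed
qed

text \<open>At the first n with J_n > i the past log-digits lie below the ramp up to an error Z =
  (1+r)^(2^i) each, while the top is at least Z^2. Since n < 16^(i+1), the total error of order n Z
  is negligible against the top, and ln q_n is essentially at most X_n/r.\<close>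

lemma ramp_digit_ge:
  assumes bdd: "peak_bounded (\<lambda>k. 2 ^ \<omega> k)"
    and early: "\<forall>\<^sub>F j in sequentially. \<exists>n<16 ^ j. j \<le> \<omega> n"
    and t: "0 \<le> t" "t < r"
  shows "\<exists>\<^sub>F n in sequentially. t * ln (real (cf_denom (ramp_digit \<omega>) n)) \<le> ln (real (ramp_digit \<omega> n))"
  unfolding frequently_sequentially
proof
  fix n0
  have r0: "r > 0" using t by linarith
  \<comment> \<open>Chosen so that the error bound 48 (t + 1) 16^i Z, with 48 = 16 * 3, becomes at
    most (1 - t/r) Z^2. Using t + 1 keeps the denominator positive when t = 0.\<close>
  define d where "d = (1 - t / r) / (48 * (t + 1))"
  have d: "d > 0" using t r0 by (simp add: d_def)
  \<comment> \<open>The condition on the sum over k < n0 keeps the first n with J_n > i from falling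
    below \<open>n0\<close>.\<close>
  have "\<forall>\<^sub>F i in sequentially. \<exists>n<16 ^ Suc i. Suc i \<le> \<omega> n"
    using early by (rule eventually_sequentially_Suc[THEN iffD2])
  then have "\<forall>\<^sub>F i in sequentially. (\<exists>n<16 ^ Suc i. Suc i \<le> \<omega> n) \<and> 16 ^ i \<le> d * (1 + r) ^ 2 ^ i \<and> (\<Sum>k<n0. \<omega> k) \<le> i"
    using power_tower_dominates[OF r0 d] by (intro eventually_conj eventually_ge_at_top)
  then obtain i where i: "\<exists>n<16 ^ Suc i. Suc i \<le> \<omega> n" "16 ^ i \<le> d * (1 + r) ^ 2 ^ i" "(\<Sum>k<n0. \<omega> k) \<le> i"
    using eventually_happens'[OF sequentially_bot] by blast
  define n where "n = (LEAST n. Suc i \<le> \<omega> n)"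
  have n: "Suc i \<le> \<omega> n" unfolding n_def using i(1) by (auto intro: LeastI)
  have n16: "n < 16 ^ Suc i" unfolding n_def using i(1) by (auto intro: le_less_trans[OF Least_le])
  have before: "2 ^ \<omega> k \<le> (2 ^ i :: nat)" if "k < n" for k
    using not_less_Least[of k "\<lambda>n. Suc i \<le> \<omega> n"] that unfolding n_def[symmetric] by (intro power_increasing) auto
  have "n0 \<le> n"
  proof (rule ccontr)
    assume "\<not> n0 \<le> n"
    then have "\<omega> n \<le> (\<Sum>k<n0. \<omega> k)" by (intro member_le_sum) auto
    then show False using i(3) n by linarith
  qed
  define X where "X = log_ramp \<omega>"
  define Z where "Z = (1 + r) ^ 2 ^ i"
  have Z: "Z \<ge> 1" unfolding Z_def using r by (intro one_le_power) auto
  have ramp: "X m \<le> X n / (1 + r) ^ (n - m) + Z" if m: "m < n" for m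
    using peak_before[OF bdd m before]
  proof
    assume "peak (\<lambda>k. 2 ^ \<omega> (m + k)) + (n - m) \<le> peak (\<lambda>k. 2 ^ \<omega> (n + k))"
    then have "(1 + r) ^ (peak (\<lambda>k. 2 ^ \<omega> (m + k)) + (n - m)) \<le> X n"
      unfolding X_def log_ramp_def using r by (intro power_increasing) auto
    then have "X m * (1 + r) ^ (n - m) \<le> X n" by (simp add: X_def log_ramp_def power_add)
    then have "X m \<le> X n / (1 + r) ^ (n - m)" using r by (subst pos_le_divide_eq) auto
    then show ?thesis using Z by linarith
  next
    assume "peak (\<lambda>k. 2 ^ \<omega> (m + k)) \<le> 2 ^ i"
    then have "X m \<le> Z" unfolding X_def log_ramp_def Z_def using r by (intro power_increasing) auto
    moreover have "X n / (1 + r) ^ (n - m) \<ge> 0" using r log_ramp_ge_1[of \<omega> n] by (simp add: X_def)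
    ultimately show ?thesis by linarith
  qed
  have denom: "ln (real (cf_denom (ramp_digit \<omega>) n)) \<le> X n / r + real n * (Z + 2)"
    using ramp log_ramp_ge_1[of \<omega> n] ramp_digit_ge_2 ln_ramp_digit(3)
    by (intro ln_cf_denom_le_at_ramp_top[OF r0]) (auto simp: X_def intro: order_trans[of _ 2])
  \<comment> \<open>Doubling the height from 2^i to 2^(i+1) squares the exponential: this is why the
    heights are powers of 2.\<close>
  have "Z * Z \<le> X n"
  proof -
    have b: "peak_bounded (\<lambda>k. 2 ^ \<omega> (n + k))" using bdd by (simp add: peak_bounded_shift[of "\<lambda>k. 2 ^ \<omega> k"])
    have "(2::nat) ^ Suc i \<le> 2 ^ \<omega> n" using n by (intro power_increasing) auto
    also have "\<dots> \<le> peak (\<lambda>k. 2 ^ \<omega> (n + k))" using le_peak[OF b, of 0] by simp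
    finally have "(1 + r) ^ (2 ^ Suc i) \<le> X n"
      unfolding X_def log_ramp_def using r by (intro power_increasing) auto
    then show ?thesis by (simp add: Z_def power_add[symmetric] mult_2)
  qed
  have "t * (real n * (Z + 2)) \<le> (t + 1) * (16 ^ Suc i * (3 * Z))"
  proof -
    have "real n \<le> real (16 ^ Suc i)" using n16 unfolding of_nat_le_iff by simp
    then show ?thesis using t Z by (intro mult_mono) auto
  qed
  also have "\<dots> = 48 * (t + 1) * 16 ^ i * Z" by simp
  also have "\<dots> \<le> 48 * (t + 1) * (d * Z) * Z"
    using i(2) t Z unfolding Z_def[symmetric] by (intro mult_right_mono mult_left_mono) auto
  also have "\<dots> = (1 - t / r) * (Z * Z)" using t by (simp add: d_def)
  also have "\<dots> \<le> (1 - t / r) * X n"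
    using \<open>Z * Z \<le> X n\<close> t r0 by (intro mult_left_mono) auto
  finally have small: "t * (real n * (Z + 2)) \<le> (1 - t / r) * X n" .
  have "t * ln (real (cf_denom (ramp_digit \<omega>) n)) \<le> t * (X n / r + real n * (Z + 2))"
    using denom t by (intro mult_left_mono) auto
  also have "\<dots> = t / r * X n + t * (real n * (Z + 2))" by (simp add: distrib_left)
  also have "\<dots> \<le> X n" using small by (simp add: algebra_simps)
  also have "\<dots> \<le> ln (real (ramp_digit \<omega> n))" using ln_ramp_digit(1) by (simp add: X_def)
  finally show "\<exists>n\<ge>n0. t * ln (real (cf_denom (ramp_digit \<omega>) n)) \<le> ln (real (ramp_digit \<omega> n))"
    using \<open>n0 \<le> n\<close> by blast
qed

end

section \<open>Measurability and transport to the unit interval\<close>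

lemma measurable_peak:
  assumes [measurable]: "\<And>k. (\<lambda>\<omega>. f \<omega> k) \<in> measurable M (count_space UNIV)"
  shows "(\<lambda>\<omega>. peak (f \<omega>)) \<in> measurable M (count_space UNIV)"
  unfolding peak_def peak_bounded_def by measurable

lemma measurable_cf_trunc:
  assumes "\<And>k. (\<lambda>\<omega>. f \<omega> k) \<in> measurable M (count_space UNIV)"
  shows "(\<lambda>\<omega>. cf_trunc (f \<omega>) n) \<in> borel_measurable M"
  using assms
proof (induction n arbitrary: f)
  case (Suc n)
  have [measurable]: "(\<lambda>\<omega>. cf_trunc (\<lambda>k. f \<omega> (Suc k)) n) \<in> borel_measurable M"
    "(\<lambda>\<omega>. f \<omega> 0) \<in> measurable M (count_space UNIV)"
    using Suc by auto
  show ?case by simp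
qed simp

lemma measurable_cf_value:
  assumes "\<And>k. (\<lambda>\<omega>. f \<omega> k) \<in> measurable M (count_space UNIV)" "\<And>\<omega> k. f \<omega> k \<ge> 2"
  shows "(\<lambda>\<omega>. cf_value (f \<omega>)) \<in> borel_measurable M"
  by (rule borel_measurable_LIMSEQ_real[where u = "\<lambda>n \<omega>. cf_trunc (f \<omega>) n"])
     (use assms in \<open>auto intro: measurable_cf_trunc cf_trunc_tendsto\<close>)

lemma measurable_gauss_map[measurable]: "gauss_map \<in> borel_measurable borel"
  unfolding gauss_map_def[abs_def] frac_def by measurable

lemma measurable_cf_digit[measurable]: "(\<lambda>x. cf_digit x n) \<in> measurable borel (count_space UNIV)"
proof -
  have "gauss_map ^^ n \<in> borel_measurable borel"
    by (induction n) (auto simp: id_def intro: measurable_comp)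
  then show ?thesis
    unfolding cf_digit_def by (rule measurable_compose[OF _ measurable_digit])
qed

lemma measurable_cf_denom[measurable]: "(\<lambda>x. cf_denom (cf_digit x) n) \<in> measurable borel (count_space UNIV)"
  by (induction n rule: induct_nat_012) simp_all

text \<open>Tolerances of the form 1/(i + 1) reduce the exponent to countably many digit conditions,
  which are measurable and so can be transported along the image measure. For r < 1/(i + 1) the
  general lower bound 2 takes over.\<close>

lemma irrationality_exponent_eqI:
  assumes x: "x \<in> irrational_unit" and r: "r \<ge> 0"
    and le: "\<And>i::nat. \<forall>\<^sub>F n in sequentially. ln (real (cf_digit x n)) \<le> (r + 1 / real (Suc i)) * ln (real (cf_denom (cf_digit x) n))"
    and ge: "\<And>i::nat. \<exists>\<^sub>F n in sequentially. (r - 1 / real (Suc i)) * ln (real (cf_denom (cf_digit x) n)) \<le> ln (real (cf_digit x n))"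
  shows "irrationality_exponent x = ereal (2 + r)"
proof (rule antisym)
  have ln0: "ln (real (cf_denom (cf_digit x) n)) \<ge> 0" for n
    using cfq_pos[OF x, of n] by simp
  show "irrationality_exponent x \<le> ereal (2 + r)"
  proof (rule irrationality_exponent_le[OF x r])
    fix t assume "t > r"
    then obtain i where i: "1 / real (Suc i) < t - r" using nat_approx_posE[of "t - r"] by auto
    show "\<forall>\<^sub>F n in sequentially. ln (real (cf_digit x n)) \<le> t * ln (real (cf_denom (cf_digit x) n))"
      using le[of i]
    proof (rule eventually_mono)
      fix n
      assume "ln (real (cf_digit x n)) \<le> (r + 1 / real (Suc i)) * ln (real (cf_denom (cf_digit x) n))"
      also have "\<dots> \<le> t * ln (real (cf_denom (cf_digit x) n))"
        using i ln0 by (intro mult_right_mono) auto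
      finally show "ln (real (cf_digit x n)) \<le> t * ln (real (cf_denom (cf_digit x) n))" .
    qed
  qed
  show "ereal (2 + r) \<le> irrationality_exponent x"
  proof (rule ereal_le_epsilon2)
    fix e :: real assume "e > 0"
    then obtain i where i: "1 / real (Suc i) < e" using nat_approx_posE by blast
    show "ereal (2 + r) \<le> irrationality_exponent x + ereal e"
    proof (cases "r - 1 / real (Suc i) \<ge> 0")
      case True
      have "ereal (2 + r) \<le> ereal (2 + (r - 1 / real (Suc i))) + ereal e" using i by simp
      also have "\<dots> \<le> irrationality_exponent x + ereal e"
        by (intro add_right_mono irrationality_exponent_ge[OF x True ge])
      finally show ?thesis .
    next
      case False
      then have "ereal (2 + r) \<le> 2 + ereal e" using i by simp
      also have "\<dots> \<le> irrationality_exponent x + ereal e"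
        by (intro add_right_mono irrationality_exponent_ge_2[OF x])
      finally show ?thesis .
    qed
  qed
qed

lemma measurable_ramp_point:
  assumes r: "r \<ge> 0"
  shows "ramp_point r \<in> measurable geometric_seq (restrict_space borel irrational_unit)"
proof (rule measurable_restrict_space2)
  have "(\<lambda>\<omega>. ramp_digit r \<omega> n) \<in> measurable geometric_seq (count_space UNIV)" for n
  proof -
    have [measurable]: "(\<lambda>\<omega>. peak (\<lambda>k. 2 ^ \<omega> (n + k))) \<in> measurable geometric_seq (count_space UNIV)"
      by (rule measurable_peak) measurable
    show ?thesis unfolding ramp_digit_def[OF r] log_ramp_def[OF r] by measurable
  qed
  then show "ramp_point r \<in> borel_measurable geometric_seq"
    unfolding ramp_point_def[OF r, abs_def] using ramp_digit_ge_2[OF r] by (intro measurable_cf_value)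
  show "ramp_point r \<in> space geometric_seq \<rightarrow> irrational_unit"
    unfolding ramp_point_def[OF r] using ramp_digit_ge_2[OF r] by (auto intro: cf_value_irrational_unit)
qed

text \<open>Each digit is the same function of the sequence seen from its own index, so the coding
  intertwines the shift with the Gauss map. Invariance and ergodicity pass to the image measure
  through this identity.\<close>

lemma gauss_map_ramp_point:
  assumes r: "r \<ge> 0"
  shows "gauss_map (ramp_point r \<omega>) = ramp_point r (seq_shift \<omega>)"
proof -
  have "ramp_digit r (seq_shift \<omega>) = (\<lambda>n. ramp_digit r \<omega> (Suc n))"
    by (simp add: fun_eq_iff ramp_digit_def[OF r] log_ramp_def[OF r] seq_shift_def)
  then show ?thesis
    unfolding ramp_point_def[OF r] using ramp_digit_ge_2[OF r] by (simp add: cf_value_digit_gauss_map(3))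
qed

lemma cf_digit_ramp_point: "r \<ge> 0 \<Longrightarrow> cf_digit (ramp_point r \<omega>) = ramp_digit r \<omega>"
  unfolding ramp_point_def using ramp_digit_ge_2 by (auto simp: cf_digit_cf_value)

theorem ex_ergodic_irrationality_exponent:
  assumes r: "r \<ge> 0"
  shows "\<exists>p \<in> borel_probabilities irrational_unit.
    invariant_measure gauss_map p \<and> ergodic_measure gauss_map p \<and>
    (AE x in p. irrationality_exponent x = ereal (2 + r))"
proof -
  define N where "N = restrict_space (borel :: real measure) irrational_unit"
  define p where "p = distr geometric_seq N (ramp_point r)"
  have \<pi>[measurable]: "ramp_point r \<in> measurable geometric_seq N"
    unfolding N_def by (rule measurable_ramp_point[OF r])
  have spN: "space N = irrational_unit" by (simp add: N_def space_restrict_space)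
  have sp: "space p = irrational_unit" by (simp add: p_def spN)
  have setsp: "sets p = sets N" by (simp add: p_def)
  have \<pi>I: "ramp_point r \<omega> \<in> irrational_unit" for \<omega>
    using measurable_space[OF \<pi>, of \<omega>] spN by simp
  have P: "p \<in> borel_probabilities irrational_unit"
    using geometric_seq.prob_space_distr[OF \<pi>] by (simp add: borel_probabilities_def p_def N_def)
  have gN: "gauss_map \<in> measurable N N"
    unfolding N_def by (rule measurable_restrict_space3) (auto intro: gauss_map_irrational_unit)
  have "distr p p gauss_map = distr p N gauss_map" by (rule distr_cong) (auto simp: setsp)
  also have "\<dots> = distr geometric_seq N (gauss_map \<circ> ramp_point r)"
    unfolding p_def by (rule distr_distr[OF gN \<pi>])
  also have "gauss_map \<circ> ramp_point r = ramp_point r \<circ> seq_shift"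
    by (simp add: fun_eq_iff gauss_map_ramp_point[OF r])
  also have "distr geometric_seq N \<dots> = distr (distr geometric_seq geometric_seq seq_shift) N (ramp_point r)"
    by (rule distr_distr[symmetric]) (auto intro: geometric_seq.T)
  also have "\<dots> = p" by (simp add: geometric_seq.T_invariant p_def)
  finally have "distr p p gauss_map = p" .
  moreover have "gauss_map \<in> measurable p p"
    using gN by (simp add: setsp cong: measurable_cong_sets)
  ultimately have inv: "invariant_measure gauss_map p" by (simp add: invariant_measure_def)
  have erg: "ergodic_measure gauss_map p"
    unfolding ergodic_measure_def
  proof (intro ballI impI)
    fix A assume A: "A \<in> sets p" "gauss_map -` A \<inter> space p = A"
    define B where "B = ramp_point r -` A \<inter> space geometric_seq"
    have B: "B \<in> sets geometric_seq" unfolding B_def using A(1) setsp by (intro measurable_sets[OF \<pi>]) auto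
    have "seq_shift \<omega> \<in> B \<longleftrightarrow> \<omega> \<in> B" for \<omega>
    proof -
      have "seq_shift \<omega> \<in> B \<longleftrightarrow> gauss_map (ramp_point r \<omega>) \<in> A"
        by (simp add: B_def gauss_map_ramp_point[OF r])
      also have "\<dots> \<longleftrightarrow> ramp_point r \<omega> \<in> gauss_map -` A \<inter> space p" using \<pi>I by (simp add: sp)
      also have "\<dots> \<longleftrightarrow> \<omega> \<in> B" unfolding A(2) by (simp add: B_def)
      finally show ?thesis .
    qed
    then have "geometric_seq.prob B = 0 \<or> geometric_seq.prob B = 1"
      by (rule geometric_seq_invariant_0_1[OF B])
    then show "measure p A = 0 \<or> measure p A = 1"
      using A(1) setsp unfolding p_def B_def by (subst (1 2) measure_distr[OF \<pi>]) auto
  qed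
  define u v where "u n x = ln (real (cf_digit x n))" and "v n x = ln (real (cf_denom (cf_digit x) n))" for n x
  \<comment> \<open>The almost sure statement is transported in terms of digits, where measurability
    is at hand; the exponent enters only afterwards, pointwise.\<close>
  define Good where "Good x \<longleftrightarrow>
    (\<forall>i::nat. \<forall>\<^sub>F n in sequentially. u n x \<le> (r + 1 / real (Suc i)) * v n x) \<and>
    (\<forall>i::nat. \<exists>\<^sub>F n in sequentially. (r - 1 / real (Suc i)) * v n x \<le> u n x)" for x
  have "u n \<in> borel_measurable borel" "v n \<in> borel_measurable borel" for n
    unfolding u_def[abs_def] v_def[abs_def] by measurable
  then have [measurable]: "u n \<in> borel_measurable N" "v n \<in> borel_measurable N" for n
    unfolding N_def by (auto intro: measurable_restrict_space1)
  have GoodN: "{x \<in> space N. Good x} \<in> sets N"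
    unfolding Good_def eventually_sequentially frequently_sequentially by measurable
  have "AE \<omega> in geometric_seq. Good (ramp_point r \<omega>)"
    using AE_peak_bounded AE_early_large_values
  proof eventually_elim
    case (elim \<omega>)
    have "\<exists>\<^sub>F n in sequentially. (r - 1 / real (Suc i)) * ln (real (cf_denom (ramp_digit r \<omega>) n)) \<le> ln (real (ramp_digit r \<omega> n))" for i
    proof (cases "r - 1 / real (Suc i) \<ge> 0")
      case True
      then show ?thesis by (intro ramp_digit_ge[OF r elim]) auto
    next
      \<comment> \<open>A negative coefficient makes the inequality trivial at every index. This
        also covers r = 0, where no t with 0 <= t < r exists.\<close>
      case False
      have "(r - 1 / real (Suc i)) * ln (real (cf_denom (ramp_digit r \<omega>) n)) \<le> ln (real (ramp_digit r \<omega> n))" for n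
      proof -
        have "cf_denom (ramp_digit r \<omega>) n \<ge> 1"
          using cfq_pos[OF \<pi>I[of \<omega>], of n] by (simp add: cf_digit_ramp_point[OF r])
        then have "(r - 1 / real (Suc i)) * ln (real (cf_denom (ramp_digit r \<omega>) n)) \<le> 0"
          using False by (intro mult_nonpos_nonneg) auto
        also have "0 \<le> ln (real (ramp_digit r \<omega> n))" using ramp_digit_ge_2[OF r, of \<omega> n] by simp
        finally show ?thesis .
      qed
      then show ?thesis by (auto simp: frequently_sequentially)
    qed
    then show ?case
      unfolding Good_def u_def v_def cf_digit_ramp_point[OF r] using ramp_digit_le[OF r] by simp
  qed
  then have "AE x in p. Good x"
    unfolding p_def using AE_distr_iff[OF \<pi> GoodN] by simp
  then have "AE x in p. irrationality_exponent x = ereal (2 + r)"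
    using AE_space
  proof eventually_elim
    case (elim x)
    then show ?case using r by (intro irrationality_exponent_eqI) (auto simp: sp Good_def u_def v_def)
  qed
  then show ?thesis using P inv erg by blast
qed

text \<open>Digits are at least 1 on the space, so log a is nonnegative and its expectation is a
  nonnegative integral; the finite and the infinite case are exhaustive.\<close>

theorem mainTheorem4:
  shows
    "(\<forall>\<mu> \<in> borel_probabilities irrational_unit.
        invariant_measure gauss_map \<mu> \<and> cf_mixing \<mu> \<longrightarrow>
          ((\<integral>\<^sup>+ x. ennreal (ln (real (digit x))) \<partial>\<mu>) < \<infinity> \<longrightarrow> (AE x in \<mu>. diophantine x)) \<and>
          ((\<integral>\<^sup>+ x. ennreal (ln (real (digit x))) \<partial>\<mu>) = \<infinity> \<longrightarrow> (AE x in \<mu>. liouville x)))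
     \<and>
     (\<forall>r::real. r \<ge> 0 \<longrightarrow>
        (\<exists>p \<in> borel_probabilities irrational_unit.
           invariant_measure gauss_map p \<and> ergodic_measure gauss_map p \<and>
           (AE x in p. irrationality_exponent x = ereal (2 + r))))"
  by (intro conjI ballI allI impI; (elim conjE)?)
     ((rule AE_diophantine; assumption), (rule AE_liouville; assumption),
      (rule ex_ergodic_irrationality_exponent; assumption))

end
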